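(* For every integer $n\ge 0$, \[B_{3}(n)=\sum_{\substack{d\mid n+1\\ d\equiv 1 \ (\mathrm{mod}\ 3)}}\Big(\frac{n+1}{d}\Big)^2-\sum_{\substack{d\mid n+1\\ d\equiv 2\ (\mathrm{mod}\ 3)}}\Big(\frac{n+1}{d}\Big)^2,\] where $d$ runs over positive divisors. Furthermore, if \[n+1=3^{\alpha}\prod_{p_i \equiv 1 \ (\mathrm{mod}\ 3)}p_{i}^{\alpha_i}\prod_{q_{j} \equiv 2 \ (\mathrm{mod}\ 3)}q_{j}^{\beta_j}\] is the prime factorization of $n+1$ (with $\alpha,\alpha_i,\beta_j\ge 0$, $p_i,q_j$ primes), then \[B_{3}(n)=3^{2\alpha}\prod_{p_i \equiv 1 \ (\mathrm{mod}\ 3)}\frac{p_{i}^{2(\alpha_i+1)}-1}{p_{i}^2-1}\prod_{q_{j} \equiv 2 \ (\mathrm{mod}\ 3)}\frac{q_{j}^{2\beta_j+2}+(-1)^{\beta_j}}{q_{j}^2+1}.\]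
   Context: A partition $\lambda$ of a nonnegative integer is called a $3$-core if none of its hook lengths is divisible by $3$. $B_3(n)$ denotes the number of partition triples of $n$ with $3$-cores, i.e. the number of ordered triples $(\lambda_1,\lambda_2,\lambda_3)$ of partitions, each a $3$-core, whose sizes sum to $n$; equivalently $\sum_{n\ge0}B_3(n)q^n=\frac{(q^3;q^3)_\infty^{9}}{(q;q)_\infty^{3}}$, where $(a;q)_\infty=\prod_{k\ge0}(1-aq^k)$. *)

theory Defs
  imports Complex_Main "HOL-Computational_Algebra.Primes"
begin

definition is_partition :: "nat list \<Rightarrow> bool" where
  "is_partition xs \<longleftrightarrow> sorted_wrt (\<ge>) xs \<and> 0 \<notin> set xs"

(* length of column j (0-indexed) of the Young diagram *)
definition conj_part :: "nat list \<Rightarrow> nat \<Rightarrow> nat" where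
  "conj_part xs j = length (filter (\<lambda>k. j < k) xs)"

(* hook length of cell (i,j), 0-indexed, for j < xs!i *)
definition hook_length :: "nat list \<Rightarrow> nat \<Rightarrow> nat \<Rightarrow> nat" where
  "hook_length xs i j = (xs ! i - j) + (conj_part xs j - i) - 1"

definition is_t_core :: "nat \<Rightarrow> nat list \<Rightarrow> bool" where
  "is_t_core t xs \<longleftrightarrow> is_partition xs \<and>
     (\<forall>i < length xs. \<forall>j < xs ! i. \<not> t dvd hook_length xs i j)"

definition B3 :: "nat \<Rightarrow> nat" where
  "B3 n = card {(a, b, c). is_t_core 3 a \<and> is_t_core 3 b \<and> is_t_core 3 c \<and>
                  sum_list a + sum_list b + sum_list c = n}"

end

theory Submission
  imports Defs "HOL-Number_Theory.Number_Theory"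
begin

text \<open>
  A partition is a 3-core iff its set of first column hook lengths is closed under subtracting 3.
  As 0 is not in this set, it is given by the numbers \<open>r\<close>, \<open>s\<close> of its elements congruent to 1 and 2,
  and the size is \<open>r\<^sup>2 - rs + s\<^sup>2 + s\<close>. So 3-cores of \<open>n\<close> correspond to Eisenstein integers of
  norm \<open>3n + 1\<close> up to units, and their number is \<open>c(n) = \<Sum>d | 3n + 1. \<chi> d\<close> with
  \<open>\<chi>\<close> the character modulo 3.
  Writing \<open>c(n)\<close> as the sum of \<open>sgn a\<close> over all integer factorisations \<open>3n + 1 = ab\<close> with
  \<open>a \<equiv> b \<equiv> 1\<close> modulo 3 makes the convolutions of \<open>c\<close> accessible to Liouville's method: the substitutions
  \<open>ab + cd = a(b + d) + (c - a)d = c(b + d) + (a - c)b\<close> turn a convolution sum into sums that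
  cancel by sign symmetries, leaving only the diagonal terms \<open>a = c\<close>. With weight 1 this
  evaluates \<open>c * c\<close> as a divisor sum, and then with weight \<open>b + d\<close> the triple convolution.
\<close>

subsection \<open>Beta-sets of 3-cores\<close>

text \<open>The character has to be encoded as a sign because the identity behind the substitutions
  sees only signs; residue conditions merely restrict it to classes that the substitutions map to
  one another. These substitutions do not preserve positivity, so sums over positive divisors would
  not be stable under them; hence signed factors, with sign 0 given to pairs of mixed sign. One, two
  and three factors live at the totals \<open>3n + 1\<close>, \<open>3n + 2\<close> and
  \<open>3n + 3\<close>. At the second total a factor congruent to 1 has a cofactor congruent to 2,
  and exchanging and negating the two reverses the sign, so unweighted sums vanish there. At the
  third total the cofactor is divisible by 3, and \<open>3n + 3 = 3(n + 1)\<close> is the origin of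
  \<open>n + 1\<close> in the formula. The triple convolution is not attacked directly: once the
  inner double one is a divisor sum, the outer one is again a sum over quadruples.\<close>

lemma is_partition_Nil [simp]: "is_partition []"
  by (simp add: is_partition_def)

lemma is_partition_Cons:
  "is_partition (x # xs) \<longleftrightarrow> 0 < x \<and> (\<forall>y\<in>set xs. y \<le> x) \<and> is_partition xs"
  by (auto simp: is_partition_def)

text \<open>\<open>x + length xs\<close> is the hook length of the leftmost cell of the row
  \<open>x\<close>: every row below it is positive and so reaches the first column.\<close>

fun beta_set :: "nat list \<Rightarrow> nat set" where
  "beta_set [] = {}"
| "beta_set (x # xs) = insert (x + length xs) (beta_set xs)"

lemma finite_beta_set [simp]: "finite (beta_set xs)"
  by (induction xs) auto

lemma beta_set_less: "\<forall>y\<in>set xs. y \<le> m \<Longrightarrow> b \<in> beta_set xs \<Longrightarrow> b < m + length xs"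
  by (induction xs arbitrary: b) force+

lemma beta_set_less_top: "is_partition (x # xs) \<Longrightarrow> b \<in> beta_set xs \<Longrightarrow> b < x + length xs"
  by (auto simp: is_partition_Cons beta_set_less)

lemma zero_notin_beta_set: "is_partition xs \<Longrightarrow> 0 \<notin> beta_set xs"
  by (induction xs) (auto simp: is_partition_Cons)

lemma card_beta_set: "is_partition xs \<Longrightarrow> card (beta_set xs) = length xs"
proof (induction xs)
  case (Cons x xs)
  then have "x + length xs \<notin> beta_set xs"
    using beta_set_less_top by blast
  with Cons show ?case by (simp add: is_partition_Cons)
qed simp

text \<open>A row with \<open>i\<close> rows below it contributes its part plus \<open>i\<close>, so
  \<open>l\<close> rows give a total excess of \<open>l * (l - 1) / 2\<close>. Doubling and
  rearranging avoids division and subtraction.\<close>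

lemma sum_beta_set:
  "is_partition xs \<Longrightarrow> 2 * \<Sum>(beta_set xs) + length xs = 2 * sum_list xs + length xs * length xs"
proof (induction xs)
  case (Cons x xs)
  then have "x + length xs \<notin> beta_set xs"
    using beta_set_less_top by blast
  with Cons show ?case by (simp add: is_partition_Cons algebra_simps)
qed simp

lemma Max_beta_set: "is_partition (x # xs) \<Longrightarrow> Max (beta_set (x # xs)) = x + length xs"
  by (rule Max_eqI) (auto dest: beta_set_less_top)

lemma beta_set_inj:
  "is_partition xs \<Longrightarrow> is_partition ys \<Longrightarrow> beta_set xs = beta_set ys \<Longrightarrow> xs = ys"
proof (induction xs arbitrary: ys)
  case Nil
  then show ?case by (cases ys) auto
next
  case (Cons x xs)
  then obtain y zs where ys: "ys = y # zs" by (cases ys) auto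
  have len: "length xs = length zs"
    using card_beta_set[OF Cons.prems(1)] card_beta_set[OF Cons.prems(2)] Cons.prems(3) ys by simp
  have top: "x + length xs = y + length zs"
    using Max_beta_set Cons.prems ys by metis
  have "beta_set xs = beta_set (x # xs) - {x + length xs}"
    using beta_set_less_top[OF Cons.prems(1)] by auto
  also have "\<dots> = beta_set (y # zs) - {y + length zs}"
    using top Cons.prems(3) ys by simp
  also have "\<dots> = beta_set zs"
    using beta_set_less_top[of y zs] Cons.prems(2) ys by auto
  finally have "xs = zs"
    using Cons ys by (simp add: is_partition_Cons)
  with len top ys show ?case by simp
qed

text \<open>Elements are inserted in increasing order, so each new maximum \<open>b\<close> becomes
  a new top row, of length \<open>b - card A\<close>. This is positive because \<open>A\<close> lies
  in \<open>{1..<b}\<close>, which is where the absence of 0 enters.\<close>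

lemma beta_set_surj:
  "finite B \<Longrightarrow> 0 \<notin> B \<Longrightarrow> \<exists>xs. is_partition xs \<and> beta_set xs = B"
proof (induction B rule: finite_linorder_max_induct)
  case empty
  show ?case by (rule exI[of _ "[]"]) simp
next
  case (insert b A)
  then obtain xs where xs: "is_partition xs" "beta_set xs = A" by auto
  have len: "length xs = card A" using card_beta_set xs by metis
  have "A \<subseteq> {1..<b}"
    using insert by (auto simp: Suc_le_eq intro: gr0I)
  then have "card A \<le> b - 1"
    by (metis card_atLeastLessThan card_mono finite_atLeastLessThan)
  moreover have "0 < b" using insert.prems by (auto intro: gr0I)
  ultimately have pos: "card A < b" by simp
  have le: "y \<le> b - card A" if "y \<in> set xs" for y
  proof (cases xs)
    case (Cons z zs)
    then have "z + length zs \<in> A" using xs by auto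
    then have "z + length zs < b" using insert by blast
    moreover have "y \<le> z" using that xs Cons by (auto simp: is_partition_Cons)
    ultimately show ?thesis using len Cons by simp
  qed (use that in simp)
  have "is_partition ((b - card A) # xs)"
    using pos le xs by (simp add: is_partition_Cons)
  moreover have "beta_set ((b - card A) # xs) = insert b A"
    using pos xs len by simp
  ultimately show ?case by blast
qed

section \<open>Hook lengths and the t-core condition\<close>

lemma conj_part_Cons: "conj_part (x # xs) j = (if j < x then Suc (conj_part xs j) else conj_part xs j)"
  by (simp add: conj_part_def)

lemma conj_part_eq_0: "\<forall>y\<in>set xs. y \<le> j \<Longrightarrow> conj_part xs j = 0"
  by (auto simp: conj_part_def filter_empty_conv)

lemma conj_part_le_length: "conj_part xs j \<le> length xs"
  by (simp add: conj_part_def)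

text \<open>Consequently the hook lengths are the differences between an element of the beta-set and a
  smaller number outside it.\<close>

lemma gap_iff:
  "is_partition xs \<Longrightarrow> c \<notin> beta_set xs \<longleftrightarrow> (\<exists>j. c + conj_part xs j = j + length xs)"
proof (induction xs)
  case Nil
  then show ?case by (simp add: conj_part_def)
next
  case (Cons x xs)
  then have le: "\<forall>y\<in>set xs. y \<le> x" and p: "is_partition xs"
    by (auto simp: is_partition_Cons)
  have conj0: "conj_part xs j = 0" if "x \<le> j" for j
    using le that by (intro conj_part_eq_0) auto
  show ?case
  proof
    assume c: "c \<notin> beta_set (x # xs)"
    then obtain j where j: "c + conj_part xs j = j + length xs"
      using Cons.IH[OF p] by auto
    show "\<exists>j. c + conj_part (x # xs) j = j + length (x # xs)"
    proof (cases "j < x")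
      case True
      then show ?thesis using j by (intro exI[of _ j]) (simp add: conj_part_Cons)
    next
      case False
      then have "c = j + length xs" using j conj0 by simp
      \<comment> \<open>Columns to the right of the top row are empty, and the additional row shifts
        their gaps by one. As \<open>c\<close> is not the new element \<open>x + length xs\<close>,
        the case \<open>j = x\<close> is excluded and column \<open>j - 1\<close> is still
        empty.\<close>
      moreover from this c have "x < j" using False by auto
      ultimately show ?thesis
        by (intro exI[of _ "j - 1"]) (simp add: conj_part_Cons conj0)
    qed
  next
    assume "\<exists>j. c + conj_part (x # xs) j = j + length (x # xs)"
    then obtain j where j: "c + conj_part (x # xs) j = j + length (x # xs)" by blast
    show "c \<notin> beta_set (x # xs)"
    proof (cases "j < x")
      case True
      then have "c + conj_part xs j = j + length xs" using j by (simp add: conj_part_Cons)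
      then show ?thesis using Cons.IH[OF p] True by auto
    next
      case False
      then have "c = Suc (j + length xs)" using j conj0 by (simp add: conj_part_Cons)
      then show ?thesis using False beta_set_less_top[OF Cons.prems, of c] by auto
    qed
  qed
qed

lemma hook_length_Cons_0:
  "j < x \<Longrightarrow> hook_length (x # xs) 0 j = x - j + conj_part xs j"
  by (simp add: hook_length_def conj_part_Cons)

lemma hook_length_Cons_Suc:
  "j < x \<Longrightarrow> hook_length (x # xs) (Suc i) j = hook_length xs i j"
  by (simp add: hook_length_def conj_part_Cons)

text \<open>The hook at column \<open>j\<close> of the top row is the largest beta-number minus the
  gap belonging to \<open>j\<close>, and the columns \<open>j < x\<close> yield exactly the gaps
  below that number.\<close>

lemma first_row_iff_gaps:
  assumes "is_partition (x # xs)"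
  shows "(\<forall>j<x. \<not> t dvd hook_length (x # xs) 0 j) \<longleftrightarrow>
         (\<forall>c < x + length xs. c \<notin> beta_set xs \<longrightarrow> \<not> t dvd x + length xs - c)"
    (is "?L \<longleftrightarrow> ?R")
proof -
  have le: "\<forall>y\<in>set xs. y \<le> x" and p: "is_partition xs"
    using assms by (auto simp: is_partition_Cons)
  show ?thesis
  proof
    assume L: ?L
    show ?R
    proof (intro allI impI)
      fix c assume c: "c < x + length xs" "c \<notin> beta_set xs"
      then obtain j where j: "c + conj_part xs j = j + length xs"
        using gap_iff[OF p] by blast
      have "j < x"
        using j c conj_part_eq_0[of xs j] le by (cases "j < x") force+
      moreover from this have "hook_length (x # xs) 0 j = x + length xs - c"
        using j by (simp add: hook_length_Cons_0)
      ultimately show "\<not> t dvd x + length xs - c" using L by metis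
    qed
  next
    assume R: ?R
    show ?L
    proof (intro allI impI)
      fix j assume j: "j < x"
      define c where "c = j + length xs - conj_part xs j"
      have c: "c + conj_part xs j = j + length xs"
        using conj_part_le_length[of xs j] by (simp add: c_def)
      then have "c \<notin> beta_set xs" using gap_iff[OF p] by blast
      moreover have "c < x + length xs" using c j by linarith
      moreover have "hook_length (x # xs) 0 j = x + length xs - c"
        using c j by (simp add: hook_length_Cons_0)
      ultimately show "\<not> t dvd hook_length (x # xs) 0 j" using R by metis
    qed
  qed
qed

lemma is_t_core_Cons:
  "is_t_core t (x # xs) \<longleftrightarrow> is_partition (x # xs) \<and> is_t_core t xs \<and>
     (\<forall>j<x. \<not> t dvd hook_length (x # xs) 0 j)"
proof (cases "is_partition (x # xs)")
  case True
  then have *: "j < x" if "i < length xs" "j < xs ! i" for i j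
    using that by (force simp: is_partition_Cons dest: nth_mem)
  have "(\<forall>i<length (x # xs). \<forall>j<(x # xs) ! i. \<not> t dvd hook_length (x # xs) i j) \<longleftrightarrow>
        (\<forall>j<x. \<not> t dvd hook_length (x # xs) 0 j) \<and>
        (\<forall>i<length xs. \<forall>j<xs ! i. \<not> t dvd hook_length (x # xs) (Suc i) j)"
    by (auto simp: All_less_Suc2)
  also have "(\<forall>i<length xs. \<forall>j<xs ! i. \<not> t dvd hook_length (x # xs) (Suc i) j) \<longleftrightarrow>
        (\<forall>i<length xs. \<forall>j<xs ! i. \<not> t dvd hook_length xs i j)"
    using * by (simp add: hook_length_Cons_Suc)
  finally show ?thesis
    using True by (auto simp: is_t_core_def is_partition_Cons)
qed (simp add: is_t_core_def)

lemma closed_diff_mult: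
  fixes B :: "nat set"
  assumes "\<forall>b\<in>B. t \<le> b \<longrightarrow> b - t \<in> B" "b \<in> B" "k * t \<le> b"
  shows "b - k * t \<in> B"
  using assms(3)
proof (induction k)
  case (Suc k)
  then have "b - k * t \<in> B" "t \<le> b - k * t" by auto
  then have "b - k * t - t \<in> B" using assms(1) by blast
  then show ?case by (simp add: add.commute)
qed (use assms in simp)

text \<open>Only the hooks of the top row are new in the induction. They avoid multiples of
  \<open>t\<close> iff no \<open>top - k * t\<close> with \<open>k > 0\<close> is a gap; once the
  lower rows form a closed set, the case \<open>k = 1\<close> implies all others.\<close>

lemma is_t_core_iff_closed:
  assumes "0 < t"
  shows "is_t_core t xs \<longleftrightarrow>
    is_partition xs \<and> (\<forall>b\<in>beta_set xs. t \<le> b \<longrightarrow> b - t \<in> beta_set xs)"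
proof (induction xs)
  case Nil
  then show ?case by (simp add: is_t_core_def)
next
  case (Cons x xs)
  show ?case
  proof (cases "is_partition (x # xs)")
    case part: True
    then have p: "is_partition xs" by (simp add: is_partition_Cons)
    let ?top = "x + length xs"
    let ?cl = "\<forall>b\<in>beta_set xs. t \<le> b \<longrightarrow> b - t \<in> beta_set xs"
    have lt: "b < ?top" if "b \<in> beta_set xs" for b
      using beta_set_less_top[OF part that] .
    \<comment> \<open>Older elements lie below the new one, so it never serves as
      \<open>b - t\<close> for any of them.\<close>
    have 1: "(\<forall>b\<in>beta_set (x # xs). t \<le> b \<longrightarrow> b - t \<in> beta_set (x # xs)) \<longleftrightarrow>
        ?cl \<and> (t \<le> ?top \<longrightarrow> ?top - t \<in> beta_set xs)"
      using lt assms by (force simp: less_imp_diff_less)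
    have 2: "(\<forall>c < ?top. c \<notin> beta_set xs \<longrightarrow> \<not> t dvd ?top - c) \<longleftrightarrow>
        (t \<le> ?top \<longrightarrow> ?top - t \<in> beta_set xs)" if cl: ?cl
    proof
      assume L: "\<forall>c < ?top. c \<notin> beta_set xs \<longrightarrow> \<not> t dvd ?top - c"
      show "t \<le> ?top \<longrightarrow> ?top - t \<in> beta_set xs"
        using L[rule_format, of "?top - t"] assms by fastforce
    next
      assume R: "t \<le> ?top \<longrightarrow> ?top - t \<in> beta_set xs"
      show "\<forall>c < ?top. c \<notin> beta_set xs \<longrightarrow> \<not> t dvd ?top - c"
      proof (intro allI impI notI)
        fix c assume c: "c < ?top" "c \<notin> beta_set xs" and "t dvd ?top - c"
        then obtain k where k: "?top - c = t * k" by (elim dvdE)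
        with c obtain k' where k': "k = Suc k'" by (cases k) auto
        have top: "?top = c + t + k' * t"
          using c(1) k mult.commute[of t k'] by (simp add: k')
        then have "?top - t \<in> beta_set xs" using R by simp
        moreover have "k' * t \<le> ?top - t" using top by simp
        ultimately have "?top - t - k' * t \<in> beta_set xs" using closed_diff_mult[OF cl] by blast
        moreover have "?top - t - k' * t = c" using top by simp
        ultimately show False using c by metis
      qed
    qed
    show ?thesis
      unfolding is_t_core_Cons first_row_iff_gaps[OF part] 1 Cons.IH using part p 2 by blast
  qed (simp add: is_t_core_def)
qed

section \<open>The abacus with three runners\<close>

lemma finite_downclosed_nat:
  fixes D :: "nat set"
  assumes "finite D" "\<And>i. Suc i \<in> D \<Longrightarrow> i \<in> D"
  shows "\<exists>r. D = {..<r}"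
proof -
  have *: "j \<in> D" if "i \<in> D" "j \<le> i" for i j
    using that(2,1) by (induction rule: inc_induct) (use assms in auto)
  show ?thesis
  proof (cases "D = {}")
    case True
    then show ?thesis by (intro exI[of _ 0]) auto
  next
    case False
    have "D = {..<Suc (Max D)}"
      unfolding lessThan_Suc_atMost
    proof (intro equalityI subsetI)
      show "j \<in> {..Max D}" if "j \<in> D" for j using that assms(1) by simp
      show "j \<in> D" if "j \<in> {..Max D}" for j
        using *[OF Max_in[OF assms(1) False]] that by simp
    qed
    then show ?thesis by blast
  qed
qed

text \<open>The abacus of a 3-core: beads pushed to the start of runners 1 and 2, with runner 0
  empty.\<close>

definition two_runners :: "nat \<times> nat \<Rightarrow> nat set" where
  "two_runners = (\<lambda>(r, s). (\<lambda>i. 3 * i + 1) ` {..<r} \<union> (\<lambda>i. 3 * i + 2) ` {..<s})"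

lemma two_runners_iff: 
  "3 * i + 1 \<in> two_runners (r, s) \<longleftrightarrow> i < r" "3 * i + 2 \<in> two_runners (r, s) \<longleftrightarrow> i < s"
proof -
  have *: "3 * a + 1 \<noteq> 3 * b + 2" for a b :: nat by presburger
  show "3 * i + 1 \<in> two_runners (r, s) \<longleftrightarrow> i < r"
    using * unfolding two_runners_def by auto
  show "3 * i + 2 \<in> two_runners (r, s) \<longleftrightarrow> i < s"
    using *[symmetric] unfolding two_runners_def by auto
qed

lemma inj_two_runners: "inj two_runners"
proof (rule injI, clarify)
  fix r s r' s' assume "two_runners (r, s) = two_runners (r', s')"
  then have "i < r \<longleftrightarrow> i < r'" "i < s \<longleftrightarrow> i < s'" for i
    using two_runners_iff by blast+
  then show "r = r' \<and> s = s'" by (metis nat_neq_iff)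
qed

lemma closed_iff_two_runners:
  "finite B \<and> 0 \<notin> B \<and> (\<forall>b\<in>B. 3 \<le> b \<longrightarrow> b - 3 \<in> B) \<longleftrightarrow> B \<in> range two_runners"
proof
  assume B: "finite B \<and> 0 \<notin> B \<and> (\<forall>b\<in>B. 3 \<le> b \<longrightarrow> b - 3 \<in> B)"
  have down: "\<exists>r. {i. 3 * i + k \<in> B} = {..<r}" for k
  proof (rule finite_downclosed_nat)
    show "finite {i. 3 * i + k \<in> B}"
      using B by (intro finite_vimageI[of B "\<lambda>i. 3 * i + k", unfolded vimage_def]) (auto simp: inj_on_def)
    show "i \<in> {i. 3 * i + k \<in> B}" if "Suc i \<in> {i. 3 * i + k \<in> B}" for i
      using B that by (force dest!: bspec[of B _ "3 * Suc i + k"])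
  qed
  obtain r s where r: "{i. 3 * i + 1 \<in> B} = {..<r}" and s: "{i. 3 * i + 2 \<in> B} = {..<s}"
    using down[of 1] down[of 2] by blast
  \<comment> \<open>Subtracting 3 repeatedly from a multiple of 3 in \<open>B\<close> would end at
    the forbidden 0.\<close>
  have nz: "b \<notin> B" if "b mod 3 = 0" for b
    using that
  proof (induction b rule: less_induct)
    case (less b)
    show ?case
    proof (cases "b = 0")
      case False
      with less.prems have "3 \<le> b" by presburger
      with less.IH[of "b - 3"] less.prems B show ?thesis by (metis diff_less le_mod_geq less_le_trans zero_less_numeral)
    qed (use B in simp)
  qed
  have "B = two_runners (r, s)"
  proof (rule Set.set_eqI)
    fix b :: nat
    have "b mod 3 < 3" by simp
    then consider "b mod 3 = 0" | "b mod 3 = 1" | "b mod 3 = 2" by linarith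
    then show "b \<in> B \<longleftrightarrow> b \<in> two_runners (r, s)"
    proof cases
      case 1
      then show ?thesis using nz by (auto simp: two_runners_def) presburger+
    next
      case 2
      then obtain i where "b = 3 * i + 1" by (metis mult_div_mod_eq)
      then show ?thesis using r two_runners_iff by blast
    next
      case 3
      then obtain i where "b = 3 * i + 2" by (metis mult_div_mod_eq)
      then show ?thesis using s two_runners_iff by blast
    qed
  qed
  then show "B \<in> range two_runners" by blast
next
  assume "B \<in> range two_runners"
  then obtain r s where B: "B = two_runners (r, s)" by auto
  show "finite B \<and> 0 \<notin> B \<and> (\<forall>b\<in>B. 3 \<le> b \<longrightarrow> b - 3 \<in> B)"
  proof (intro conjI ballI impI)
    fix b assume b: "b \<in> B" "3 \<le> b"
    then consider i where "b = 3 * i + 1" "i < r" | i where "b = 3 * i + 2" "i < s"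
      by (auto simp: B two_runners_def)
    then show "b - 3 \<in> B"
    proof cases
      case 1
      then show ?thesis using two_runners_iff(1)[of "i - 1" r s] b B by (cases i) auto
    next
      case 2
      then show ?thesis using two_runners_iff(2)[of "i - 1" r s] b B by (cases i) auto
    qed
  qed (auto simp: B two_runners_def)
qed

lemma card_two_runners: "card (two_runners (r, s)) = r + s"
  and sum_two_runners: "2 * \<Sum>(two_runners (r, s)) + r = 3 * r * r + 3 * s * s + s"
proof -
  have disj: "(\<lambda>i. 3 * i + 1) ` {..<r} \<inter> (\<lambda>i. 3 * i + 2) ` {..<s} = {}"
    by auto presburger
  have inj: "inj_on (\<lambda>i::nat. 3 * i + k) A" for k A by (auto simp: inj_on_def)
  show "card (two_runners (r, s)) = r + s"
    unfolding two_runners_def using disj by (simp add: card_Un_disjoint card_image inj[of 1, simplified] inj[of 2, simplified])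
  have "\<Sum>(two_runners (r, s)) = (\<Sum>i<r. 3 * i + 1) + (\<Sum>i<s. 3 * i + 2)"
    unfolding two_runners_def prod.case
    by (subst sum.union_disjoint) (use disj in \<open>auto simp: sum.reindex inj[of 1, simplified] inj[of 2, simplified]\<close>)
  moreover have "2 * (\<Sum>i<r. 3 * i + 1) + r = 3 * r * r" for r :: nat
    by (induction r) (auto simp: algebra_simps)
  moreover have "2 * (\<Sum>i<s. 3 * i + 2) = 3 * s * s + s" for s :: nat
    by (induction s) (auto simp: algebra_simps)
  ultimately show "2 * \<Sum>(two_runners (r, s)) + r = 3 * r * r + 3 * s * s + s"
    by (simp add: algebra_simps)
qed

text \<open>The term \<open>r * s\<close> of the size formula stands on the other side of the
  equation to avoid truncated subtraction.\<close>

lemma card_three_cores: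
  "card {xs. is_t_core 3 xs \<and> sum_list xs = n} =
   card {(r, s). r * r + s * s + s = n + r * s}"
proof -
  let ?C = "{xs. is_t_core 3 xs \<and> sum_list xs = n}" and ?P = "{(r, s). r * r + s * s + s = n + r * s}"
  have size: "sum_list xs = n \<longleftrightarrow> (r, s) \<in> ?P"
    if "is_partition xs" "beta_set xs = two_runners (r, s)" for xs r s
  proof -
    have len: "length xs = r + s"
      using card_beta_set[OF that(1)] that(2) card_two_runners by simp
    have "2 * \<Sum>(beta_set xs) + length xs = 2 * sum_list xs + length xs * length xs"
      using sum_beta_set[OF that(1)] .
    then have "2 * sum_list xs + (r + s) * (r + s) = 2 * \<Sum>(two_runners (r, s)) + (r + s)"
      using that(2) len by simp
    also have "\<dots> = 3 * r * r + 3 * s * s + s + s" using sum_two_runners[of r s] by linarith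
    finally have "2 * sum_list xs + 2 * (r * s) = 2 * (r * r + s * s + s)" by (simp add: algebra_simps)
    then show ?thesis by (auto)
  qed
  have "beta_set ` ?C = two_runners ` ?P"
  proof (intro equalityI subsetI)
    fix B assume "B \<in> beta_set ` ?C"
    then obtain xs where xs: "is_t_core 3 xs" "sum_list xs = n" "B = beta_set xs" by blast
    then have p: "is_partition xs" and cl: "\<forall>b\<in>beta_set xs. 3 \<le> b \<longrightarrow> b - 3 \<in> beta_set xs"
      using is_t_core_iff_closed[of 3 xs] by auto
    have "beta_set xs \<in> range two_runners"
      using cl closed_iff_two_runners[of "beta_set xs"] zero_notin_beta_set[OF p] finite_beta_set by blast
    then obtain r s where "beta_set xs = two_runners (r, s)" by auto
    then show "B \<in> two_runners ` ?P" using size[OF p] xs by blast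
  next
    fix B assume "B \<in> two_runners ` ?P"
    then obtain r s where rs: "(r, s) \<in> ?P" "B = two_runners (r, s)" by blast
    then have B: "finite B \<and> 0 \<notin> B \<and> (\<forall>b\<in>B. 3 \<le> b \<longrightarrow> b - 3 \<in> B)"
      using closed_iff_two_runners by blast
    then obtain xs where xs: "is_partition xs" "beta_set xs = B" using beta_set_surj by blast
    then have "is_t_core 3 xs" using B is_t_core_iff_closed[of 3 xs] by simp
    moreover have "sum_list xs = n" using size xs rs by blast
    ultimately show "B \<in> beta_set ` ?C" using xs by blast
  qed
  moreover have "inj_on beta_set ?C"
    by (rule inj_onI) (auto simp: is_t_core_def intro: beta_set_inj)
  moreover have "inj_on two_runners ?P" using inj_two_runners inj_on_subset by blast
  ultimately show ?thesis using card_image[of beta_set ?C] card_image[of two_runners ?P] by simp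
qed

subsection \<open>Eisenstein integers of given norm\<close>

text \<open>The pair \<open>(a, b)\<close> stands for \<open>a + b * \<omega>\<close> with a
  primitive cube root of unity \<open>\<omega>\<close>. The product and the conjugate below come
  from \<open>\<omega>^2 = -1 - \<omega>\<close>.\<close>

definition eis_norm :: "int \<times> int \<Rightarrow> int" where
  "eis_norm = (\<lambda>(a, b). a * a - a * b + b * b)"

definition eis_mult :: "int \<times> int \<Rightarrow> int \<times> int \<Rightarrow> int \<times> int" where
  "eis_mult = (\<lambda>(u, v) (a, b). (a * u - b * v, a * v + b * u - b * v))"

definition eis_conj :: "int \<times> int \<Rightarrow> int \<times> int" where
  "eis_conj = (\<lambda>(u, v). (u - v, - v))"

definition eis_of_norm :: "int \<Rightarrow> (int \<times> int) set" where
  "eis_of_norm N = {x. eis_norm x = N}"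

lemma eis_norm_mult: "eis_norm (eis_mult x y) = eis_norm x * eis_norm y"
  by (cases x; cases y) (simp add: eis_norm_def eis_mult_def algebra_simps)

lemma eis_norm_conj [simp]: "eis_norm (eis_conj x) = eis_norm x"
  by (cases x) (simp add: eis_norm_def eis_conj_def algebra_simps)

lemma eis_conj_conj [simp]: "eis_conj (eis_conj x) = x"
  by (cases x) (simp add: eis_conj_def)

lemma eis_mult_conj_cancel:
  "eis_mult (eis_conj x) (eis_mult x (a, b)) = (eis_norm x * a, eis_norm x * b)"
  by (cases x) (simp add: eis_norm_def eis_mult_def eis_conj_def algebra_simps)

lemma eis_mult_conj_cancel':
  "eis_mult x (eis_mult (eis_conj x) (a, b)) = (eis_norm x * a, eis_norm x * b)"
  using eis_mult_conj_cancel[of "eis_conj x"] by simp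

lemma eis_mult_scale: "eis_mult x (k * a, k * b) = (k * fst (eis_mult x (a, b)), k * snd (eis_mult x (a, b)))"
  by (cases x) (simp add: eis_mult_def algebra_simps)

lemma eis_norm_scale: "eis_norm (k * a, k * b) = k * k * eis_norm (a, b)"
  by (simp add: eis_norm_def algebra_simps)

lemma inj_eis_mult: "eis_norm x \<noteq> 0 \<Longrightarrow> inj (eis_mult x)"
proof (rule injI, clarify)
  fix a b c d assume nz: "eis_norm x \<noteq> 0" and eq: "eis_mult x (a, b) = eis_mult x (c, d)"
  have "(eis_norm x * a, eis_norm x * b) = (eis_norm x * c, eis_norm x * d)"
    unfolding eis_mult_conj_cancel[symmetric] eq ..
  then show "a = c \<and> b = d" using nz by simp
qed

lemma eis_norm_bound:
  assumes "eis_norm (a, b) = N"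
  shows "3 * (a * a) \<le> 4 * N" "3 * (b * b) \<le> 4 * N"
proof -
  have "4 * N = 3 * (a * a) + (2 * b - a) * (2 * b - a)" "4 * N = 3 * (b * b) + (2 * a - b) * (2 * a - b)"
    using assms by (auto simp: eis_norm_def algebra_simps)
  then show "3 * (a * a) \<le> 4 * N" "3 * (b * b) \<le> 4 * N"
    by (metis le_add_same_cancel1 zero_le_square)+
qed

lemma abs_le_square_int: "\<bar>a\<bar> \<le> a * (a::int)"
proof (cases "a = 0")
  case False
  then have "\<bar>a\<bar> * 1 \<le> \<bar>a\<bar> * \<bar>a\<bar>" by (intro mult_left_mono) auto
  then show ?thesis by (simp add: abs_mult_self_eq)
qed simp

lemma finite_eis_of_norm [simp]: "finite (eis_of_norm N)"
proof (rule finite_subset)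
  show "eis_of_norm N \<subseteq> {-4*N..4*N} \<times> {-4*N..4*N}"
  proof (clarify, simp add: eis_of_norm_def)
    fix a b assume "eis_norm (a, b) = N"
    from eis_norm_bound[OF this] abs_le_square_int[of a] abs_le_square_int[of b]
    show "- (4 * N) \<le> a \<and> a \<le> 4 * N \<and> - (4 * N) \<le> b \<and> b \<le> 4 * N" 
      by (auto simp: abs_le_iff)
  qed
qed simp

section \<open>Inert and split primes\<close>

lemma fermat_theorem_int:
  fixes a :: int
  assumes "prime p" "\<not> int p dvd a"
  shows "[a ^ (p - 1) = 1] (mod int p)"
proof -
  define c where "c = nat (a mod int p)"
  have c: "int c = a mod int p"
    using assms(1) by (simp add: c_def prime_gt_0_nat)
  have "\<not> p dvd c"
    using assms(2) c by (metis dvd_mod_iff dvd_refl int_dvd_int_iff)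
  then have "[c ^ (p - 1) = 1] (mod p)" using fermat_theorem assms(1) by blast
  then have "[int c ^ (p - 1) = 1] (mod int p)"
    by (metis cong_int_iff of_nat_1 of_nat_power)
  moreover have "[a ^ (p - 1) = int c ^ (p - 1)] (mod int p)"
    by (rule cong_pow) (simp add: c)
  ultimately show ?thesis using cong_trans by blast
qed

lemma prime_not_dvd_3:
  assumes "prime p" "p mod 3 \<noteq> 0"
  shows "\<not> int p dvd 3"
proof
  assume "int p dvd 3"
  then have "int p dvd int 3" by simp
  then have dvd: "p dvd 3" by (simp only: int_dvd_int_iff)
  then have "p \<le> 3" by (rule dvd_imp_le) simp
  moreover have "1 < p" using assms(1) prime_gt_1_nat by blast
  moreover have "p \<noteq> 3" using assms(2) by auto
  ultimately have "p = 2" by linarith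
  then show False using dvd by simp
qed

text \<open>Modulo an inert prime cubing is injective, and \<open>a\<^sup>3 + b\<^sup>3 = (a + b) (a\<^sup>2 - ab + b\<^sup>2)\<close>.\<close>

lemma inert_prime_dvd:
  assumes p: "prime p" "p mod 3 = 2" and dvd: "int p dvd eis_norm (a, b)"
  shows "int p dvd a \<and> int p dvd b"
proof -
  have pp: "prime (int p)" using p by simp
  have dvd_sq: "int p dvd x" if "int p dvd x * x" for x
    using that prime_dvd_mult_iff[OF pp] by blast
  have iff: "int p dvd a \<longleftrightarrow> int p dvd b"
  proof
    assume a: "int p dvd a"
    have "b * b = eis_norm (a, b) - a * (a - b)" by (simp add: eis_norm_def algebra_simps)
    then have "int p dvd b * b" using a dvd by simp
    then show "int p dvd b" by (rule dvd_sq)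
  next
    assume b: "int p dvd b"
    have "a * a = eis_norm (a, b) - b * (b - a)" by (simp add: eis_norm_def algebra_simps)
    then have "int p dvd a * a" using b dvd by simp
    then show "int p dvd a" by (rule dvd_sq)
  qed
  show ?thesis
  proof (rule ccontr)
    assume "\<not> ?thesis"
    with iff have na: "\<not> int p dvd a" and nb: "\<not> int p dvd - b" by auto
    define k where "k = p div 3"
    \<comment> \<open>This exponent lets the cube determine the number: Fermat reads
      \<open>(a^3)^k * a = 1\<close> modulo \<open>p\<close>, and likewise for \<open>- b\<close>,
      so equal cubes give \<open>a = - b\<close>.\<close>
    have pk: "p - 1 = 3 * k + 1" using p(2) by (simp add: k_def) presburger
    have "a ^ 3 - (- b) ^ 3 = (a + b) * eis_norm (a, b)"
      by (simp add: eis_norm_def algebra_simps power3_eq_cube)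
    then have cube: "[a ^ 3 = (- b) ^ 3] (mod int p)"
      using dvd by (simp add: cong_iff_dvd_diff)
    have "[(- b) ^ (3 * k) * a = a ^ (3 * k) * a] (mod int p)"
      using cong_pow[OF cong_sym[OF cube], of k] by (intro cong_mult) (auto simp: power_mult)
    also have "a ^ (3 * k) * a = a ^ (p - 1)" by (subst pk) simp
    also have "[a ^ (p - 1) = 1] (mod int p)" using fermat_theorem_int[OF p(1) na] .
    also have "[1 = (- b) ^ (p - 1)] (mod int p)" using cong_sym[OF fermat_theorem_int[OF p(1) nb]] .
    also have "(- b) ^ (p - 1) = (- b) ^ (3 * k) * (- b)" by (subst pk) simp
    finally have "[(- b) ^ (3 * k) * a = (- b) ^ (3 * k) * (- b)] (mod int p)" .
    moreover have "coprime ((- b) ^ (3 * k)) (int p)"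
      using prime_imp_coprime[OF pp nb]
      by (subst coprime_power_left_iff) (simp add: coprime_commute)
    ultimately have "[a = - b] (mod int p)" using cong_mult_lcancel by blast
    then have ab: "int p dvd a + b" by (simp add: cong_iff_dvd_diff)
    have "3 * (b * b) = eis_norm (a, b) - (a + b) * (a - 2 * b)"
      by (simp add: eis_norm_def algebra_simps)
    then have "int p dvd 3 * (b * b)" using ab dvd by simp
    then have "int p dvd b * b"
      using prime_dvd_mult_iff[OF pp, of 3] prime_not_dvd_3[OF p(1)] p(2) by simp
    from dvd_sq[OF this] show False using nb by simp
  qed
qed

text \<open>As 3 divides \<open>p - 1\<close>, a power of a primitive root has order 3. Its negative
  is a root of the sixth cyclotomic polynomial \<open>z^2 - z + 1\<close>.\<close>

lemma prime_sixth_root_of_unity: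
  assumes p: "prime p" "p mod 3 = 1"
  shows "\<exists>z. int p dvd z * z - z + 1"
proof -
  have p1: "1 < p" using p prime_gt_1_nat by blast
  then obtain g where g: "residue_primroot p g"
    using prime_primitive_root_exists[of p] p by blast
  then have ord: "ord p g = p - 1"
    using p by (simp add: residue_primroot_def totient_prime)
  define w where "w = int g ^ ((p - 1) div 3)"
  have p3: "3 dvd p - 1" using p(2) p1 by presburger
  have "\<not> (p - 1) dvd (p - 1) div 3"
  proof
    assume "(p - 1) dvd (p - 1) div 3"
    moreover have "0 < (p - 1) div 3" "(p - 1) div 3 < p - 1" using p3 p1 by auto
    ultimately show False using dvd_imp_le[of "p - 1" "(p - 1) div 3"] by linarith
  qed
  then have "\<not> [g ^ ((p - 1) div 3) = 1] (mod p)"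
    using ord_divides[of g "(p - 1) div 3" p] ord by simp
  then have "\<not> [w = 1] (mod int p)"
    unfolding w_def by (metis cong_int_iff of_nat_1 of_nat_power)
  then have w1: "\<not> int p dvd w - 1" by (simp add: cong_iff_dvd_diff)
  have "[g ^ (p - 1) = 1] (mod p)" using ord_divides[of g "p - 1" p] ord by simp
  moreover have "int (g ^ (p - 1)) = w ^ 3"
    using p3 by (simp add: w_def flip: power_mult)
  ultimately have "[w ^ 3 = 1] (mod int p)" by (metis cong_int_iff of_nat_1)
  then have "int p dvd w ^ 3 - 1" by (simp add: cong_iff_dvd_diff)
  also have "w ^ 3 - 1 = (w - 1) * (w * w + w + 1)" by (simp add: power3_eq_cube algebra_simps)
  finally have "int p dvd w * w + w + 1"
    using w1 p prime_dvd_mult_iff[of "int p"] by auto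
  then show ?thesis by (intro exI[of _ "- w"]) simp
qed

text \<open>Thue's argument: more than \<open>p\<close> pairs with coordinates at most
  \<open>sqrt p\<close> force a small nonzero \<open>(u, v)\<close> with \<open>u = z * v\<close>
  modulo \<open>p\<close>. Its norm is a multiple of \<open>p\<close> below \<open>3 * p\<close>,
  and \<open>2 * p\<close> is ruled out by parity.\<close>

lemma split_prime_is_norm:
  assumes p: "prime p" "p mod 3 = 1"
  shows "\<exists>x. eis_norm x = int p"
proof -
  obtain z where z: "int p dvd z * z - z + 1" using prime_sixth_root_of_unity[OF p] by blast
  have p0: "0 < p" using p(1) prime_gt_0_nat by blast
  define k where "k = nat \<lfloor>sqrt (real p)\<rfloor>"
  have k_le: "k * k \<le> p" and k_gt: "p < (k + 1) * (k + 1)"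
  proof -
    have k: "real k \<le> sqrt (real p)" "sqrt (real p) < real k + 1" by (auto simp: k_def)
    have "real k * real k \<le> sqrt (real p) * sqrt (real p)"
      by (rule mult_mono) (use k in auto)
    moreover have "sqrt (real p) * sqrt (real p) < (real k + 1) * (real k + 1)"
      by (rule mult_strict_mono') (use k in auto)
    ultimately have "real (k * k) \<le> real p" "real p < real ((k + 1) * (k + 1))"
      by (simp_all add: algebra_simps)
    then show "k * k \<le> p" "p < (k + 1) * (k + 1)" by (simp_all only: of_nat_le_iff of_nat_less_iff)
  qed
  \<comment> \<open>A prime is no square; this makes the bounds on \<open>u * u\<close> and
    \<open>v * v\<close> strict, so that \<open>t = 3\<close> cannot occur below.\<close>
  have k_ne: "k * k \<noteq> p"
  proof
    assume k: "k * k = p"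
    then have "k = 1 \<or> k = p" using p(1) by (metis dvd_triv_left prime_nat_iff)
    then show False using k p by (auto simp: prime_nat_iff)
  qed
  define f where "f = (\<lambda>(x::nat, y::nat). (int x - z * int y) mod int p)"
  let ?A = "{..k} \<times> {..k}"
  have "f ` ?A \<subseteq> {0..<int p}" using p0 by (auto simp: f_def)
  then have "card (f ` ?A) \<le> p" using card_mono[of "{0..<int p}" "f ` ?A"] by simp
  also have "p < card ?A" using k_gt by (simp add: card_cartesian_product)
  finally have "\<not> inj_on f ?A" by (rule pigeonhole)
  then obtain x y x' y' where xy: "x \<le> k" "y \<le> k" "x' \<le> k" "y' \<le> k"
    "(x, y) \<noteq> (x', y')" "f (x, y) = f (x', y')"
    unfolding inj_on_def by auto
  define u v where "u = int x - int x'" and "v = int y - int y'"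
  have "int p dvd (int x - z * int y) - (int x' - z * int y')"
    using xy(6) unfolding f_def by (simp add: mod_eq_dvd_iff)
  also have "\<dots> = u - z * v" by (simp add: u_def v_def algebra_simps)
  finally have dvd1: "int p dvd u - z * v" .
  \<comment> \<open>Modulo \<open>p\<close> the norm form splits into linear factors because
    \<open>z\<close> is a root of \<open>z^2 - z + 1\<close>.\<close>
  have "eis_norm (u, v) = (u - z * v) * (u + z * v - v) + v * v * (z * z - z + 1)"
    by (simp add: eis_norm_def algebra_simps)
  then have dvd: "int p dvd eis_norm (u, v)" using dvd1 z by simp
  have sq: "t * t < int p" if "\<bar>t\<bar> \<le> int k" for t
  proof -
    have "t * t = \<bar>t\<bar> * \<bar>t\<bar>" by simp
    also have "\<dots> \<le> int k * int k" using that by (intro mult_mono) auto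
    also have "\<dots> < int p" using k_le k_ne by (metis le_neq_implies_less of_nat_less_iff of_nat_mult)
    finally show ?thesis .
  qed
  have uu: "u * u < int p" and vv: "v * v < int p" using xy by (auto intro!: sq simp: u_def v_def)
  have "2 * eis_norm (u, v) \<le> 3 * (u * u) + 3 * (v * v)"
    using zero_le_square[of "u + v"] by (simp add: eis_norm_def algebra_simps)
  with uu vv have lt: "eis_norm (u, v) < 3 * int p" by linarith
  have "0 < eis_norm (u, v)"
  proof (rule ccontr)
    assume "\<not> 0 < eis_norm (u, v)"
    with eis_norm_bound[of u v, OF refl] have "3 * (u * u) \<le> 0" "3 * (v * v) \<le> 0" by linarith+
    then have "u = 0" "v = 0" by (auto simp: mult_le_0_iff)
    then show False using xy(5) by (simp add: u_def v_def)
  qed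
  moreover obtain t where t: "eis_norm (u, v) = int p * t" using dvd by (elim dvdE)
  ultimately have "0 < t" "t < 3"
    using lt p0 by (simp_all add: zero_less_mult_iff mult.commute[of 3])
  then consider "t = 1" | "t = 2" by linarith
  then show ?thesis
  proof cases
    case 1
    then show ?thesis using t by auto
  next
    case 2
    \<comment> \<open>The norm is even only if both coordinates are, and is then divisible by 4; so
      \<open>2 * p\<close> could be a norm only for an even \<open>p\<close>.\<close>
    have "even (eis_norm (u, v))" using t 2 by simp
    then have "even u" "even v" by (auto simp: eis_norm_def)
    then obtain u' v' where "u = 2 * u'" "v = 2 * v'" by (elim evenE)
    then have "int p = 2 * eis_norm (u', v')" using t 2 by (simp add: eis_norm_scale)
    then have "even p" by (metis dvd_triv_left even_of_nat_iff)
    then have "p = 2" using p(1) primes_dvd_imp_eq two_is_prime_nat by metis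
    then show ?thesis using p(2) by simp
  qed
qed

section \<open>Elements of norm \<open>p * N\<close> in terms of those of norm \<open>N\<close> and
  \<open>N / p\<close>\<close>

text \<open>These are the elements of norm \<open>p * N\<close> divisible by \<open>p\<close>.
  Writing \<open>int p * eis_norm x = int N\<close> instead of dividing makes the set empty when
  \<open>p\<close> does not divide \<open>N\<close>, as the recursion requires.\<close>

definition scaled_eis :: "nat \<Rightarrow> nat \<Rightarrow> (int \<times> int) set" where
  "scaled_eis p N = (\<lambda>(a, b). (int p * a, int p * b)) ` {x. int p * eis_norm x = int N}"

lemma scaled_eis_iff: "(a, b) \<in> scaled_eis p N \<longleftrightarrow>
   int p dvd a \<and> int p dvd b \<and> eis_norm (a, b) = int p * int N" if "0 < p"
proof
  assume "(a, b) \<in> scaled_eis p N"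
  then show "int p dvd a \<and> int p dvd b \<and> eis_norm (a, b) = int p * int N"
    by (auto simp: scaled_eis_def eis_norm_scale)
next
  assume *: "int p dvd a \<and> int p dvd b \<and> eis_norm (a, b) = int p * int N"
  then obtain a' b' where ab: "a = int p * a'" "b = int p * b'" by (elim conjE dvdE)
  then have "int p * eis_norm (a', b') = int N"
    using * that by (simp add: eis_norm_scale)
  then show "(a, b) \<in> scaled_eis p N" by (auto simp: scaled_eis_def ab)
qed

lemma card_scaled_eis:
  assumes "0 < p"
  shows "card (scaled_eis p N) = (if p dvd N then card (eis_of_norm (int (N div p))) else 0)"
proof -
  have "card (scaled_eis p N) = card {x. int p * eis_norm x = int N}"
    unfolding scaled_eis_def using assms by (intro card_image) (auto simp: inj_on_def)
  also have "{x. int p * eis_norm x = int N} = (if p dvd N then eis_of_norm (int (N div p)) else {})"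
  proof (cases "p dvd N")
    case True
    then obtain M where "N = p * M" by (elim dvdE)
    then show ?thesis using assms by (auto simp: eis_of_norm_def)
  next
    case False
    then show ?thesis by (auto simp flip: int_dvd_int_iff) (metis dvd_triv_left)
  qed
  finally show ?thesis by simp
qed

lemma eis_of_norm_inert:
  assumes "prime p" "p mod 3 = 2"
  shows "eis_of_norm (int (p * N)) = scaled_eis p N"
proof (rule Set.set_eqI, clarify)
  fix a b
  have "eis_norm (a, b) = int p * int N \<Longrightarrow> int p dvd a \<and> int p dvd b"
    using inert_prime_dvd[OF assms, of a b] by simp
  then show "(a, b) \<in> eis_of_norm (int (p * N)) \<longleftrightarrow> (a, b) \<in> scaled_eis p N"
    using prime_gt_0_nat[OF assms(1)] by (auto simp: scaled_eis_iff eis_of_norm_def)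
qed

text \<open>Divisibility by \<open>x\<close> becomes a test on integer coordinates: \<open>y\<close>
  is a multiple of \<open>x\<close> iff the conjugate of \<open>x\<close> times \<open>y\<close> is
  divisible by the norm \<open>p\<close>.\<close>

lemma eis_mult_image:
  assumes "eis_norm x = int p" "0 < p"
  shows "eis_mult x ` eis_of_norm (int N) =
    {y \<in> eis_of_norm (int (p * N)). int p dvd fst (eis_mult (eis_conj x) y) \<and> int p dvd snd (eis_mult (eis_conj x) y)}"
    (is "?L = ?R")
proof (intro equalityI subsetI)
  fix y assume "y \<in> ?L"
  then obtain z where "eis_norm z = int N" "y = eis_mult x z" unfolding eis_of_norm_def by blast
  then obtain a b where "eis_norm (a, b) = int N" "y = eis_mult x (a, b)" by (cases z) blast
  then show "y \<in> ?R"
    using assms by (simp add: eis_of_norm_def eis_norm_mult eis_mult_conj_cancel)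
next
  fix y assume y: "y \<in> ?R"
  obtain a b where ab: "eis_mult (eis_conj x) y = (a, b)" by fastforce
  then obtain a' b' where ab': "a = int p * a'" "b = int p * b'" using y by (auto elim!: dvdE)
  have "eis_mult x (a, b) = (int p * fst y, int p * snd y)"
    using eis_mult_conj_cancel'[of x "fst y" "snd y"] assms ab by simp
  then have yy: "eis_mult x (a', b') = y"
    using assms eis_mult_scale[of x "int p" a' b'] by (simp add: ab' prod_eq_iff)
  then have "eis_norm x * eis_norm (a', b') = int p * int N"
    using y by (simp add: eis_of_norm_def flip: eis_norm_mult)
  then have "eis_norm (a', b') = int N" using assms by simp
  then show "y \<in> ?L" using yy by (auto simp: eis_of_norm_def)
qed

text \<open>The two numbers are the second coordinates of \<open>(a, b)\<close> times the conjugate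
  of \<open>(u, v)\<close> and times \<open>(u, v)\<close> itself. Their product is a combination of
  the two norms, so primality in the integers replaces unique factorisation of Eisenstein
  integers.\<close>

lemma split_prime_dvd_snd:
  assumes p: "prime p" "eis_norm (u, v) = int p" and ab: "int p dvd eis_norm (a, b)"
  shows "int p dvd b * u - a * v \<or> int p dvd a * v + b * u - b * v"
proof -
  have "(b * u - a * v) * (a * v + b * u - b * v) = b * b * eis_norm (u, v) - v * v * eis_norm (a, b)"
    by (simp add: eis_norm_def algebra_simps)
  then have "int p dvd (b * u - a * v) * (a * v + b * u - b * v)" using p(2) ab by simp
  then show ?thesis using p(1) prime_dvd_mult_iff[of "int p"] by auto
qed

text \<open>The norm is the square of the first coordinate modulo the second. Thus the divisibility
  test for multiples of \<open>x\<close> needs only the second coordinate.\<close>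

lemma dvd_snd_imp_dvd_fst:
  assumes p: "prime p" and "int p dvd eis_norm x" and "int p dvd snd x"
  shows "int p dvd fst x"
proof -
  have "fst x * fst x = eis_norm x - snd x * (snd x - fst x)"
    by (cases x) (simp add: eis_norm_def algebra_simps)
  then have "int p dvd fst x * fst x" using assms by simp
  then show ?thesis using p prime_dvd_mult_iff[of "int p"] by auto
qed

text \<open>Inclusion and exclusion: an element of norm \<open>p * N\<close> is a multiple of
  \<open>(u, v)\<close> or of its conjugate, each kind being counted by the elements of norm
  \<open>N\<close>, and it is a multiple of both iff \<open>p\<close> divides it.\<close>

lemma card_eis_of_norm_split:
  assumes p: "prime p" "p mod 3 = 1"
  shows "int (card (eis_of_norm (int (p * N)))) =
     2 * int (card (eis_of_norm (int N))) - int (card (scaled_eis p N))"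
proof -
  have p0: "0 < p" using p(1) prime_gt_0_nat by blast
  have pp: "prime (int p)" using p by simp
  obtain u v where uv: "eis_norm (u, v) = int p" using split_prime_is_norm[OF p] by force
  have uv': "eis_norm (eis_conj (u, v)) = int p" using uv by simp
  let ?E = "eis_of_norm (int N)"
  let ?A = "eis_mult (u, v) ` ?E" and ?B = "eis_mult (eis_conj (u, v)) ` ?E"
  \<comment> \<open>Otherwise \<open>p\<close> would divide both coordinates, and \<open>p^2\<close>
    the norm \<open>p\<close>.\<close>
  have v: "\<not> int p dvd v"
  proof
    assume v: "int p dvd v"
    then have "int p dvd u" using dvd_snd_imp_dvd_fst[OF p(1), of "(u, v)"] uv by simp
    with v obtain u' v' where "u = int p * u'" "v = int p * v'" by (elim dvdE)
    then have "int p * (int p * eis_norm (u', v')) = int p * 1"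
      using uv by (simp add: eis_norm_scale)
    then have "int p * eis_norm (u', v') = 1" using p0 by simp
    then have "int p dvd 1" by (metis dvd_triv_left)
    then show False using pp not_prime_unit by blast
  qed
  have fst: "int p dvd fst (eis_mult z y)"
    if "y \<in> eis_of_norm (int (p * N))" "int p dvd snd (eis_mult z y)" for z y
    using dvd_snd_imp_dvd_fst[OF p(1), of "eis_mult z y"] that
    by (simp add: eis_of_norm_def eis_norm_mult)
  have A: "?A = {y \<in> eis_of_norm (int (p * N)). int p dvd snd (eis_mult (eis_conj (u, v)) y)}"
    unfolding eis_mult_image[OF uv p0] using fst by blast
  have B: "?B = {y \<in> eis_of_norm (int (p * N)). int p dvd snd (eis_mult (u, v) y)}"
    unfolding eis_mult_image[OF uv' p0] eis_conj_conj using fst by blast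
  have union: "eis_of_norm (int (p * N)) = ?A \<union> ?B"
  proof -
    have "int p dvd snd (eis_mult (eis_conj (u, v)) (a, b)) \<or> int p dvd snd (eis_mult (u, v) (a, b))"
      if "(a, b) \<in> eis_of_norm (int (p * N))" for a b
      using split_prime_dvd_snd[OF p(1) uv, of a b] that
      by (simp add: eis_mult_def eis_conj_def eis_of_norm_def algebra_simps)
    then show ?thesis unfolding A B by auto
  qed
  have inter: "?A \<inter> ?B = scaled_eis p N"
  proof (intro equalityI subsetI)
    fix y assume y: "y \<in> ?A \<inter> ?B"
    obtain a b where ab: "y = (a, b)" by fastforce
    have N: "eis_norm (a, b) = int p * int N"
      and d1: "int p dvd b * u - a * v" and d2: "int p dvd a * v + b * u - b * v"
      using y unfolding A B ab by (auto simp: eis_mult_def eis_conj_def eis_of_norm_def algebra_simps)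
    \<comment> \<open>Adding the two second coordinates isolates \<open>b\<close>. The cofactor
      \<open>2 * u - v\<close> is prime to \<open>p\<close> since
      \<open>4 * p = (2 * u - v)^2 + 3 * v^2\<close>: the prime is not ramified.\<close>
    have "b * (2 * u - v) = (b * u - a * v) + (a * v + b * u - b * v)" by (simp add: algebra_simps)
    then have "int p dvd b * (2 * u - v)" using d1 d2 by (metis dvd_add)
    moreover have "\<not> int p dvd 2 * u - v"
    proof
      assume "int p dvd 2 * u - v"
      moreover have "3 * (v * v) = 4 * eis_norm (u, v) - (2 * u - v) * (2 * u - v)"
        by (simp add: eis_norm_def algebra_simps)
      ultimately have "int p dvd 3 * (v * v)" using uv by simp
      then show False
        using v prime_dvd_mult_iff[OF pp, of 3] prime_dvd_mult_iff[OF pp, of v v] prime_not_dvd_3[OF p(1)] p(2) by simp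
    qed
    ultimately have b: "int p dvd b" using prime_dvd_mult_iff[OF pp] by blast
    moreover have "int p dvd a"
      using dvd_snd_imp_dvd_fst[OF p(1), of "(a, b)"] N b by simp
    ultimately show "y \<in> scaled_eis p N" using scaled_eis_iff[OF p0] N ab by blast
  next
    fix y assume y: "y \<in> scaled_eis p N"
    obtain a b where ab: "y = (a, b)" by fastforce
    with y have *: "int p dvd a" "int p dvd b" "eis_norm (a, b) = int p * int N"
      using scaled_eis_iff[OF p0] by auto
    then show "y \<in> ?A \<inter> ?B"
      unfolding A B ab by (auto simp: eis_mult_def eis_conj_def eis_of_norm_def)
  qed
  have "card ?A + card ?B = card (?A \<union> ?B) + card (?A \<inter> ?B)"
    by (intro card_Un_Int) auto
  moreover have "card ?A = card ?E" "card ?B = card ?E"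
    using inj_eis_mult uv uv' p0 by (auto intro!: card_image inj_on_subset[OF inj_eis_mult])
  ultimately show ?thesis unfolding union inter by linarith
qed

section \<open>The character sum and the count up to units\<close>

definition chi3 :: "nat \<Rightarrow> int" where
  "chi3 d = (if d mod 3 = 1 then 1 else if d mod 3 = 2 then - 1 else 0)"

lemma chi3_mult: "chi3 (a * b) = chi3 a * chi3 b"
proof -
  have "(a * b) mod 3 = ((a mod 3) * (b mod 3)) mod 3" by (simp add: mod_mult_eq)
  moreover have "a mod 3 < 3" "b mod 3 < 3" by simp_all
  then have "a mod 3 = 0 \<or> a mod 3 = 1 \<or> a mod 3 = 2" "b mod 3 = 0 \<or> b mod 3 = 1 \<or> b mod 3 = 2" by linarith+
  ultimately show ?thesis by (auto simp: chi3_def)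
qed

definition chi3_sum :: "nat \<Rightarrow> int" where
  "chi3_sum N = (\<Sum>d | d dvd N. chi3 d)"

text \<open>The divisors of \<open>p * N\<close> are those of \<open>N\<close> together with their
  \<open>p\<close>-fold multiples; the overlap consists of the \<open>p * e\<close> dividing
  \<open>N\<close>, and is what the last term removes.\<close>

lemma chi3_sum_prime_mult:
  assumes p: "prime p" and N: "0 < N"
  shows "chi3_sum (p * N) = (1 + chi3 p) * chi3_sum N -
     chi3 p * (if p dvd N then chi3_sum (N div p) else 0)"
proof -
  have p0: "0 < p" using p prime_gt_0_nat by blast
  let ?A = "{d. d dvd N}" and ?B = "(*) p ` {d. d dvd N}" and ?C = "{e. p * e dvd N}"
  have fin: "finite ?A" "finite ?B" using N by auto
  have inj: "inj_on ((*) p) A" for A using p0 by (auto simp: inj_on_def)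
  have un: "{d. d dvd p * N} = ?A \<union> ?B"
  proof (intro equalityI subsetI)
    fix d assume d: "d \<in> {d. d dvd p * N}"
    show "d \<in> ?A \<union> ?B"
    proof (cases "p dvd d")
      case True
      then obtain e where "d = p * e" by (elim dvdE)
      then show ?thesis using d p0 by auto
    next
      case False
      then have "coprime d p" using p by (metis coprime_commute prime_imp_coprime)
      then show ?thesis using d coprime_dvd_mult_right_iff by auto
    qed
  qed auto
  have int: "?A \<inter> ?B = (*) p ` ?C" by (auto dest: dvd_mult_right)
  have C: "sum chi3 ?C = (if p dvd N then chi3_sum (N div p) else 0)"
  proof (cases "p dvd N")
    case True
    then obtain M where "N = p * M" by (elim dvdE)
    then show ?thesis using p0 by (simp add: chi3_sum_def)
  next
    case False
    then have "?C = {}" by (auto dest: dvd_mult_left)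
    then show ?thesis using False by (simp only: sum.empty if_False)
  qed
  have "chi3_sum (p * N) + sum chi3 ((*) p ` ?C) = sum chi3 ?A + sum chi3 ?B"
    unfolding chi3_sum_def un int[symmetric] using sum.union_inter[OF fin] .
  moreover have "sum chi3 ((*) p ` X) = chi3 p * sum chi3 X" for X
    by (simp add: sum.reindex[OF inj] chi3_mult sum_distrib_left)
  ultimately show ?thesis using C by (simp add: chi3_sum_def algebra_simps)
qed

lemma eis_of_norm_1: "eis_of_norm 1 = {(1, 0), (-1, 0), (0, 1), (0, -1), (1, 1), (-1, -1)}"
proof (intro equalityI subsetI)
  fix x assume "x \<in> eis_of_norm 1"
  then obtain a b where x: "x = (a, b)" and ab: "eis_norm (a, b) = 1"
    by (cases x) (auto simp: eis_of_norm_def)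
  have "\<bar>a\<bar> \<le> 1" "\<bar>b\<bar> \<le> 1"
    using eis_norm_bound[OF ab] abs_le_square_int[of a] abs_le_square_int[of b] by linarith+
  then have "a = -1 \<or> a = 0 \<or> a = 1" "b = -1 \<or> b = 0 \<or> b = 1" by linarith+
  then show "x \<in> {(1, 0), (-1, 0), (0, 1), (0, -1), (1, 1), (-1, -1)}"
    using ab x by (auto simp: eis_norm_def)
qed (auto simp: eis_of_norm_def eis_norm_def)

text \<open>Both sides satisfy the recursion \<open>f (p N) = (1 + \<chi> p) f N - \<chi> p f (N / p)\<close>.\<close>

lemma card_eis_of_norm:
  "\<not> 3 dvd N \<Longrightarrow> int (card (eis_of_norm (int N))) = 6 * chi3_sum N"
proof (induction N rule: less_induct)
  case (less N)
  show ?case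
  proof (cases "N = 1")
    case True
    have "chi3_sum 1 = 1" by (simp add: chi3_sum_def chi3_def)
    then show ?thesis using True eis_of_norm_1 by simp
  next
    case False
    then obtain p M where p: "prime p" and N: "N = p * M"
      using prime_factor_nat[of N] by (auto elim: dvdE)
    have p1: "1 < p" using p prime_gt_1_nat by blast
    have M: "0 < M" "M < N" "\<not> 3 dvd M" "\<not> 3 dvd p"
      using less.prems p1 N by (auto intro!: gr0I)
    have IH1: "int (card (eis_of_norm (int M))) = 6 * chi3_sum M" using less.IH M by blast
    have IH2: "int (card (scaled_eis p M)) = 6 * (if p dvd M then chi3_sum (M div p) else 0)"
    proof (cases "p dvd M")
      case True
      then have "M div p < N" "\<not> 3 dvd M div p"
        using M div_le_dividend[of M p] by (linarith, metis dvd_div_mult_self dvd_mult2)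
      then show ?thesis using True less.IH card_scaled_eis[of p M] p1 by simp
    qed (use card_scaled_eis[of p M] p1 in simp)
    have "p mod 3 < 3" "p mod 3 \<noteq> 0" using M by (auto simp: dvd_eq_mod_eq_0)
    then consider "p mod 3 = 1" | "p mod 3 = 2" by linarith
    then show ?thesis
    proof cases
      case 1
      then show ?thesis
        using card_eis_of_norm_split[OF p, of M] chi3_sum_prime_mult[OF p M(1)] IH1 IH2
        by (simp add: N chi3_def)
    next
      case 2
      then have "chi3 p = - 1" by (simp add: chi3_def)
      then show ?thesis
        unfolding N eis_of_norm_inert[OF p 2] chi3_sum_prime_mult[OF p M(1)] IH2 by simp
    qed
  qed
qed

text \<open>Multiplication by \<open>\<omega>\<close> permutes \<open>a - 2b\<close>, \<open>b - 2a\<close>, \<open>a + b\<close> cyclically;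
  these are nonzero numbers with sum zero, so exactly one rotation of each element lies in the sector
  \<open>a - 2b > 0 > b - 2a\<close>.\<close>

lemma card_eis_of_norm_sector:
  fixes N :: int
  assumes N: "N mod 3 = 1"
  shows "card (eis_of_norm N) =
    6 * card {(a, b). eis_norm (a, b) = N \<and> (a + b) mod 3 = 1 \<and> a - 2 * b > 0 \<and> b - 2 * a < 0}"
proof -
  let ?E = "eis_of_norm N"
  define T where "T = {x \<in> ?E. (fst x + snd x) mod 3 = 1}"
  define T' where "T' = {x \<in> ?E. (fst x + snd x) mod 3 = 2}"
  define S where "S = {(a, b) \<in> T. a - 2 * b > 0 \<and> b - 2 * a < 0}"
  define S1 where "S1 = {(a, b) \<in> T. a + b > 0 \<and> a - 2 * b < 0}"
  define S2 where "S2 = {(a, b) \<in> T. b - 2 * a > 0 \<and> a + b < 0}"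
  have fin: "finite T" "finite T'" "finite S" "finite S1" "finite S2"
    unfolding S_def S1_def S2_def T_def T'_def
    by (auto intro: finite_subset[OF _ finite_eis_of_norm[of N]])
  \<comment> \<open>The norm is \<open>(a + b)^2 - 3 * a * b\<close>, so \<open>a + b\<close> is
    prime to 3, and residue 1 selects one element from each pair \<open>x\<close>,
    \<open>- x\<close>. This accounts for the units 1 and -1.\<close>
  have "?E = T \<union> T'"
  proof -
    have "(a + b) mod 3 = 1 \<or> (a + b) mod 3 = 2" if "eis_norm (a, b) = N" for a b
    proof -
      have "\<not> 3 dvd a + b"
      proof
        assume "3 dvd a + b"
        moreover have "N = (a + b) * (a + b) - 3 * (a * b)"
          using that by (simp add: eis_norm_def algebra_simps)
        ultimately have "3 dvd N" by simp
        then show False using N by simp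
      qed
      moreover have "(a + b) mod 3 < 3" "0 \<le> (a + b) mod 3" by simp_all
      ultimately show ?thesis by (simp add: dvd_eq_mod_eq_0) linarith
    qed
    then show ?thesis unfolding T_def T'_def eis_of_norm_def by force
  qed
  moreover have "T \<inter> T' = {}" by (auto simp: T_def T'_def)
  moreover have "card T = card T'"
  proof (rule bij_betw_same_card)
    have neg: "(- c - d) mod 3 = 2 \<longleftrightarrow> (c + d) mod 3 = 1" "(- c - d) mod 3 = 1 \<longleftrightarrow> (c + d) mod 3 = 2"
      for c d :: int by presburger+
    show "bij_betw (\<lambda>(a, b). (- a, - b)) T T'"
      by (rule bij_betwI[where g = "\<lambda>(a, b). (- a, - b)"])
        (auto simp: T_def T'_def eis_of_norm_def eis_norm_def neg)
  qed
  ultimately have "card ?E = 2 * card T" using fin by (simp add: card_Un_disjoint)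
  also have "T = S \<union> S1 \<union> S2"
  proof (intro equalityI subsetI)
    fix x assume x: "x \<in> T"
    obtain a b where ab: "x = (a, b)" by fastforce
    then have "(a + b) mod 3 = 1" using x by (simp add: T_def)
    \<comment> \<open>All three numbers are congruent to \<open>a + b\<close> modulo 3, hence to
      1.\<close>
    then have "a + b \<noteq> 0" "a - 2 * b \<noteq> 0" "b - 2 * a \<noteq> 0" by presburger+
    then show "x \<in> S \<union> S1 \<union> S2" using x ab by (simp add: S_def S1_def S2_def) linarith
  qed (auto simp: S_def S1_def S2_def)
  also have "card \<dots> = card S + card S1 + card S2"
  proof -
    have "S \<inter> S1 = {}" "(S \<union> S1) \<inter> S2 = {}" by (auto simp: S_def S1_def S2_def)
    then show ?thesis using fin by (simp add: card_Un_disjoint)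
  qed
  also have "card S + card S1 + card S2 = 3 * card S"
  proof -
    have m: "(- d + (c - d)) mod 3 = 1 \<longleftrightarrow> (c + d) mod 3 = 1" "(d - c + - c) mod 3 = 1 \<longleftrightarrow> (c + d) mod 3 = 1"
      for c d :: int by presburger+
    have "bij_betw (\<lambda>(a, b). (- b, a - b)) S S1"
      by (rule bij_betwI[where g = "\<lambda>(a, b). (b - a, - a)"])
        (use m in \<open>auto simp: S_def S1_def T_def eis_of_norm_def eis_norm_def algebra_simps\<close>)
    then have 1: "card S1 = card S" by (simp add: bij_betw_same_card)
    have "bij_betw (\<lambda>(a, b). (- b, a - b)) S1 S2"
      by (rule bij_betwI[where g = "\<lambda>(a, b). (b - a, - a)"])
        (use m in \<open>auto simp: S1_def S2_def T_def eis_of_norm_def eis_norm_def algebra_simps\<close>)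
    then have "card S2 = card S1" by (simp add: bij_betw_same_card)
    with 1 show ?thesis by simp
  qed
  also have "S = {(a, b). eis_norm (a, b) = N \<and> (a + b) mod 3 = 1 \<and> a - 2 * b > 0 \<and> b - 2 * a < 0}"
    by (auto simp: S_def T_def eis_of_norm_def)
  finally show ?thesis by simp
qed

lemma card_quadratic_pairs:
  "int (card {(r, s). r * r + s * s + s = n + r * s}) = chi3_sum (3 * n + 1)"
proof -
  define P where "P = {(r, s). r * r + s * s + s = n + r * s}"
  define S where "S = {(a, b). eis_norm (a, b) = int (3 * n + 1) \<and> (a + b) mod 3 = 1 \<and>
    a - 2 * b > 0 \<and> b - 2 * a < 0}"
  \<comment> \<open>The solution of \<open>a - 2 * b = 3 * r + 1\<close> and
    \<open>2 * a - b = 3 * s + 2\<close>, the first free positions on the two runners. The sector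
    inequalities thus become \<open>r \<ge> 0\<close> and \<open>s \<ge> 0\<close>.\<close>
  define f where "f = (\<lambda>(r, s). (2 * int s - int r + 1, int s - 2 * int r))"
  have norm: "eis_norm (f (r, s)) = int (3 * n + 1) \<longleftrightarrow> (r, s) \<in> P" for r s
  proof -
    have "(r, s) \<in> P \<longleftrightarrow> int (r * r + s * s + s) = int (n + r * s)"
      unfolding P_def by (simp only: of_nat_eq_iff) simp
    moreover have "eis_norm (f (r, s)) - int (3 * n + 1) = 3 * (int (r * r + s * s + s) - int (n + r * s))"
      by (simp add: eis_norm_def f_def algebra_simps)
    moreover have "x = y \<longleftrightarrow> a = b" if "x - y = 3 * (a - b)" for x y a b :: int
      using that by auto
    ultimately show ?thesis by blast
  qed
  have "f ` P = S"
  proof (intro equalityI subsetI)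
    fix x assume "x \<in> f ` P"
    then obtain r s where rs: "(r, s) \<in> P" "x = f (r, s)" by auto
    have "(2 * int s - int r + 1 + (int s - 2 * int r)) mod 3 = 1" by presburger
    with rs show "x \<in> S" using norm[of r s] by (simp add: S_def f_def)
  next
    fix x assume "x \<in> S"
    then obtain a b where x: "x = (a, b)" and ab: "eis_norm (a, b) = int (3 * n + 1)"
      "(a + b) mod 3 = 1" "a - 2 * b > 0" "b - 2 * a < 0" unfolding S_def by blast
    have "(a - 2 * b - 1) mod 3 = 0" "(2 * a - b - 2) mod 3 = 0" using ab(2) by presburger+
    then have "3 * ((a - 2 * b - 1) div 3) = a - 2 * b - 1" "3 * ((2 * a - b - 2) div 3) = 2 * a - b - 2"
      by presburger+
    moreover have "0 \<le> (a - 2 * b - 1) div 3" "0 \<le> (2 * a - b - 2) div 3"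
      using ab(2,3,4) by presburger+
    ultimately obtain r s where "3 * int r = a - 2 * b - 1" "3 * int s = 2 * a - b - 2"
      by (metis nat_0_le)
    then have "x = f (r, s)" by (auto simp: x f_def)
    then show "x \<in> f ` P" using norm[of r s] ab(1) x by auto
  qed
  moreover have "inj_on f P" by (auto simp: inj_on_def f_def)
  ultimately have "card S = card P" using card_image by metis
  moreover have "int (3 * n + 1) mod 3 = 1" by presburger
  then have "card (eis_of_norm (int (3 * n + 1))) = 6 * card S"
    unfolding S_def by (rule card_eis_of_norm_sector)
  moreover have "\<not> 3 dvd 3 * n + 1" by presburger
  then have "int (card (eis_of_norm (int (3 * n + 1)))) = 6 * chi3_sum (3 * n + 1)"
    by (rule card_eis_of_norm)
  ultimately show ?thesis unfolding P_def by linarith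
qed

subsection \<open>Convolution sums\<close>

text \<open>The value 0 on mixed signs lets a term simply vanish when a substitution leaves the
  range of factorisations of positive numbers.\<close>

definition sgn_pair :: "int \<Rightarrow> int \<Rightarrow> int" where
  "sgn_pair x y = (if 0 < x \<and> 0 < y then 1 else if x < 0 \<and> y < 0 then - 1 else 0)"

definition int_divs :: "int \<Rightarrow> (int \<times> int) set" where
  "int_divs A = {(a, b). a * b = A}"

text \<open>Positivity of both products makes the set finite; \<open>a * b + c * d = N\<close> alone
  has infinitely many integer solutions.\<close>

definition quads :: "int \<Rightarrow> (int \<times> int \<times> int \<times> int) set" where
  "quads N = {(a, b, c, d). 0 < a * b \<and> 0 < c * d \<and> a * b + c * d = N}"

lemma sgn_pair_eq_0: "\<not> 0 < x * y \<Longrightarrow> sgn_pair x y = 0"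
  by (auto simp: sgn_pair_def zero_less_mult_iff)

lemma sgn_pair_minus: "sgn_pair (- x) (- y) = - sgn_pair x y"
  by (auto simp: sgn_pair_def)

lemma sgn_pair_commute: "sgn_pair x y = sgn_pair y x"
  by (auto simp: sgn_pair_def)

lemma finite_int_divs: "0 < A \<Longrightarrow> finite (int_divs A)"
proof (rule finite_subset)
  assume A: "0 < A"
  show "int_divs A \<subseteq> {- A..A} \<times> {- A..A}"
  proof (clarify, simp add: int_divs_def)
    fix a b assume ab: "a * b = A"
    then have "a dvd A" "b dvd A" by auto
    then have "\<bar>a\<bar> \<le> A" "\<bar>b\<bar> \<le> A" using A dvd_imp_le_int[of A] by auto
    then show "- A \<le> a \<and> a \<le> A \<and> - A \<le> b \<and> b \<le> A" by linarith
  qed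
qed simp

lemma sum_quads:
  "(\<Sum>(a, b, c, d)\<in>quads N. F a b c d) =
   (\<Sum>A\<in>{0<..<N}. \<Sum>(a, b)\<in>int_divs A. \<Sum>(c, d)\<in>int_divs (N - A). (F a b c d :: int))"
proof -
  have "(\<Sum>A\<in>{0<..<N}. \<Sum>(a, b)\<in>int_divs A. \<Sum>(c, d)\<in>int_divs (N - A). F a b c d) =
    (\<Sum>A\<in>{0<..<N}. \<Sum>(x, y)\<in>int_divs A \<times> int_divs (N - A). F (fst x) (snd x) (fst y) (snd y))"
    by (intro sum.cong refl) (simp add: case_prod_beta sum.cartesian_product)
  also have "\<dots> = (\<Sum>(A, x, y)\<in>(SIGMA A:{0<..<N}. int_divs A \<times> int_divs (N - A)). F (fst x) (snd x) (fst y) (snd y))"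
    by (subst sum.Sigma) (auto simp: finite_int_divs case_prod_beta)
  also have "\<dots> = (\<Sum>(a, b, c, d)\<in>quads N. F a b c d)"
    by (rule sum.reindex_bij_witness[where j = "\<lambda>(A, x, y). (fst x, snd x, fst y, snd y)"
          and i = "\<lambda>(a, b, c, d). (a * b, (a, b), (c, d))"])
      (auto simp: quads_def int_divs_def)
  finally show ?thesis ..
qed

lemma sum_quads_mult:
  "(\<Sum>(a, b, c, d)\<in>quads N. f a b * g c d) =
   (\<Sum>A\<in>{0<..<N}. (\<Sum>(a, b)\<in>int_divs A. f a b) * (\<Sum>(c, d)\<in>int_divs (N - A). (g c d :: int)))"
  unfolding sum_quads by (simp add: case_prod_beta sum_product)

lemma finite_quads: "finite (quads N)"
proof (rule finite_subset)
  show "quads N \<subseteq> (\<lambda>((a, b), (c, d)). (a, b, c, d)) `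
    ((\<Union>A\<in>{0<..<N}. int_divs A) \<times> (\<Union>A\<in>{0<..<N}. int_divs A))"
    by (force simp: quads_def int_divs_def image_iff)
qed (auto simp: finite_int_divs)

text \<open>The coefficient form of Fay's trisecant identity
  \<open>F(u,v) F(u',v') = F(u,v+v') F(u'-u,v') + F(u',v+v') F(u-u',v)\<close> for the Kronecker function
  \<open>F\<close>, whose Laurent coefficients are the values of \<^const>\<open>sgn_pair\<close>.\<close>

lemma sgn_pair_fay:
  assumes "a \<noteq> 0" "b \<noteq> 0" "c \<noteq> 0" "d \<noteq> 0" "c \<noteq> a" "b + d \<noteq> 0"
  shows "sgn_pair a b * sgn_pair c d =
    sgn_pair a (b + d) * sgn_pair (c - a) d + sgn_pair c (b + d) * sgn_pair (a - c) b"
proof -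
  have "0 < a \<or> a < 0" "0 < b \<or> b < 0" "0 < c \<or> c < 0" "0 < d \<or> d < 0"
    "a < c \<or> c < a" "0 < b + d \<or> b + d < 0" using assms by linarith+
  then show ?thesis unfolding sgn_pair_def by (elim disjE; simp)
qed

text \<open>Both substitutions preserve \<open>a * b + c * d\<close> and are invertible on integer
  quadruples, so the pointwise identity can be summed and reindexed. The conditions
  \<open>e \<noteq> d\<close> and \<open>h + a \<noteq> 0\<close> say that the old entries
  \<open>b\<close> and \<open>c\<close> are nonzero; the second sum is read in the same way.\<close>

lemma sum_quads_fay:
  fixes g :: "int \<Rightarrow> int \<Rightarrow> int \<Rightarrow> int \<Rightarrow> int"
  shows "(\<Sum>(a, b, c, d) | (a, b, c, d) \<in> quads N \<and> c \<noteq> a \<and> b + d \<noteq> 0.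
      sgn_pair a b * sgn_pair c d * g a b c d) =
    (\<Sum>(a, e, h, d) | (a, e, h, d) \<in> quads N \<and> e \<noteq> d \<and> h + a \<noteq> 0.
      sgn_pair a e * sgn_pair h d * g a (e - d) (h + a) d) +
    (\<Sum>(c, e, k, b) | (c, e, k, b) \<in> quads N \<and> e \<noteq> b \<and> k + c \<noteq> 0.
      sgn_pair c e * sgn_pair k b * g (k + c) b c (e - b))"
proof -
  define P where "P = {(a, b, c, d). a * b + c * d = N \<and> a \<noteq> 0 \<and> b \<noteq> 0 \<and> c \<noteq> 0 \<and> d \<noteq> 0 \<and> c \<noteq> a \<and> b + d \<noteq> 0}"
  define ph where "ph = (\<lambda>(a :: int, b :: int, c :: int, d :: int). (a, b + d, c - a, d))"
  define ps where "ps = (\<lambda>(a :: int, b :: int, c :: int, d :: int). (c, b + d, a - c, b))"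
  define ph' where "ph' = (\<lambda>(a :: int, e :: int, h :: int, d :: int). (a, e - d, h + a, d))"
  define ps' where "ps' = (\<lambda>(c :: int, e :: int, k :: int, b :: int). (k + c, b, c, e - b))"
  \<comment> \<open>\<open>P\<close>, where the identity applies, is infinite. \<open>E\<close> is a
    finite part of it containing the support of all three summands; outside \<open>quads N\<close>
    they are 0 because one of the products is not positive.\<close>
  define E where "E = P \<inter> (quads N \<union> ph' ` quads N \<union> ps' ` quads N)"
  have finE: "finite E" unfolding E_def using finite_quads by blast
  define f where "f = (\<lambda>(a, b, c, d). sgn_pair a b * sgn_pair c d * g a b c d)"
  define f1 where "f1 = (\<lambda>(a, e, h, d). sgn_pair a e * sgn_pair h d * g a (e - d) (h + a) d)"
  define f2 where "f2 = (\<lambda>(c, e, k, b). sgn_pair c e * sgn_pair k b * g (k + c) b c (e - b))"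
  define Q where "Q = {(a, b, c, d). (a, b, c, d) \<in> quads N \<and> c \<noteq> a \<and> b + d \<noteq> 0}"
  define Q1 where "Q1 = {(a, e, h, d). (a, e, h, d) \<in> quads N \<and> e \<noteq> d \<and> h + a \<noteq> 0}"
  have zero: "sgn_pair a b * sgn_pair c d = 0" if "(a, b, c, d) \<notin> quads N" "a * b + c * d = N" for a b c d
    using that sgn_pair_eq_0[of a b] sgn_pair_eq_0[of c d] by (auto simp: quads_def)
  have inv: "ph' (ph x) = x" "ps' (ps x) = x" "ph (ph' x) = x" "ps (ps' x) = x" for x
    by (cases x; simp add: ph_def ph'_def ps_def ps'_def)+
  have inj: "inj_on ph E" "inj_on ps E"
    by (rule inj_on_inverseI, rule inv)+
  have "sum f Q = sum f E"
  proof (rule sum.mono_neutral_left[OF finE])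
    show "Q \<subseteq> E"
    proof
      fix x assume "x \<in> Q"
      then obtain a b c d where x: "x = (a, b, c, d)" "x \<in> quads N" "c \<noteq> a" "b + d \<noteq> 0"
        unfolding Q_def by blast
      then have "x \<in> P" by (auto simp: P_def quads_def)
      then show "x \<in> E" using x(2) by (simp add: E_def)
    qed
    show "\<forall>x\<in>E - Q. f x = 0"
    proof
      fix x assume x: "x \<in> E - Q"
      then obtain a b c d where abcd: "x = (a, b, c, d)" "(a, b, c, d) \<in> P"
        unfolding E_def P_def by blast
      then have "(a, b, c, d) \<notin> quads N" "a * b + c * d = N" using x by (auto simp: Q_def P_def)
      then show "f x = 0" using zero[of a b c d] abcd(1) by (simp add: f_def)
    qed
  qed
  also have "\<dots> = (\<Sum>x\<in>E. f1 (ph x) + f2 (ps x))"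
  proof (rule sum.cong[OF refl])
    fix x assume "x \<in> E"
    then obtain a b c d where x: "x = (a, b, c, d)"
      and *: "a \<noteq> 0" "b \<noteq> 0" "c \<noteq> 0" "d \<noteq> 0" "c \<noteq> a" "b + d \<noteq> 0"
      unfolding E_def P_def by blast
    have "f x = (sgn_pair a (b + d) * sgn_pair (c - a) d + sgn_pair c (b + d) * sgn_pair (a - c) b) * g a b c d"
      by (simp add: x f_def sgn_pair_fay[OF *])
    then show "f x = f1 (ph x) + f2 (ps x)"
      by (simp add: x f1_def f2_def ph_def ps_def distrib_right)
  qed
  also have "\<dots> = (\<Sum>x\<in>E. f1 (ph x)) + (\<Sum>x\<in>E. f2 (ps x))" by (rule sum.distrib)
  also have "(\<Sum>x\<in>E. f1 (ph x)) = sum f1 (ph ` E)"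
    by (simp add: sum.reindex inj o_def)
  also have "\<dots> = sum f1 Q1"
  proof (rule sum.mono_neutral_right)
    show "Q1 \<subseteq> ph ` E"
    proof
      fix x assume "x \<in> Q1"
      then obtain a e h d where x: "x = (a, e, h, d)" "(a, e, h, d) \<in> quads N" "e \<noteq> d" "h + a \<noteq> 0"
        unfolding Q1_def by blast
      then have "ph' x \<in> P" by (auto simp: P_def ph'_def quads_def algebra_simps)
      then have "ph' x \<in> E" using x by (auto simp: E_def)
      then show "x \<in> ph ` E" using inv by (metis imageI)
    qed
    show "\<forall>x\<in>ph ` E - Q1. f1 x = 0"
    proof
      fix x assume x: "x \<in> ph ` E - Q1"
      then obtain a b c d where abcd: "x = ph (a, b, c, d)" "(a, b, c, d) \<in> P"
        by (auto simp: E_def)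
      then have "(a, b + d, c - a, d) \<notin> quads N" using x by (auto simp: Q1_def ph_def P_def)
      moreover have "a * (b + d) + (c - a) * d = N" using abcd by (simp add: P_def algebra_simps)
      ultimately show "f1 x = 0" using zero[of a "b + d" "c - a" d] abcd(1) by (simp add: f1_def ph_def)
    qed
  qed (use finE in simp)
  also have "(\<Sum>x\<in>E. f2 (ps x)) = sum f2 (ps ` E)"
    by (simp add: sum.reindex inj o_def)
  also have "\<dots> = sum f2 Q1"
  proof (rule sum.mono_neutral_right)
    show "Q1 \<subseteq> ps ` E"
    proof
      fix x assume "x \<in> Q1"
      then obtain a e h d where x: "x = (a, e, h, d)" "(a, e, h, d) \<in> quads N" "e \<noteq> d" "h + a \<noteq> 0"
        unfolding Q1_def by blast
      then have "ps' x \<in> P" by (auto simp: P_def ps'_def quads_def algebra_simps)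
      then have "ps' x \<in> E" using x by (auto simp: E_def)
      then show "x \<in> ps ` E" using inv by (metis imageI)
    qed
    show "\<forall>x\<in>ps ` E - Q1. f2 x = 0"
    proof
      fix x assume x: "x \<in> ps ` E - Q1"
      then obtain a b c d where abcd: "x = ps (a, b, c, d)" "(a, b, c, d) \<in> P"
        by (auto simp: E_def)
      then have "(c, b + d, a - c, b) \<notin> quads N" using x by (auto simp: Q1_def ps_def P_def)
      moreover have "c * (b + d) + (a - c) * b = N" using abcd by (simp add: P_def algebra_simps)
      ultimately show "f2 x = 0" using zero[of c "b + d" "a - c" b] abcd(1) by (simp add: f2_def ps_def)
    qed
  qed (use finE in simp)
  finally show ?thesis unfolding f_def f1_def f2_def Q_def Q1_def .
qed

section \<open>Residue classes modulo 3 and the diagonal terms\<close>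

lemma card_mod3_pos:
  fixes e :: int
  assumes "e mod 3 \<noteq> 1" "0 < e"
  shows "int (card {b. 0 < b \<and> b < e \<and> b mod 3 = 1}) = (e + 1) div 3"
proof -
  have "bij_betw (\<lambda>j. 3 * j + 1) {0..<(e + 1) div 3} {b. 0 < b \<and> b < e \<and> b mod 3 = 1}"
  proof (rule bij_betwI[where g = "\<lambda>b. b div 3"])
    show "(\<lambda>j. 3 * j + 1) \<in> {0..<(e + 1) div 3} \<rightarrow> {b. 0 < b \<and> b < e \<and> b mod 3 = 1}"
      using assms by (auto; presburger)
    show "(\<lambda>b. b div 3) \<in> {b. 0 < b \<and> b < e \<and> b mod 3 = 1} \<rightarrow> {0..<(e + 1) div 3}"
      using assms by (auto; presburger)
    show "3 * (b div 3) + 1 = b" if "b \<in> {b. 0 < b \<and> b < e \<and> b mod 3 = 1}" for b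
      using that mult_div_mod_eq[of 3 b] by simp
  qed simp
  then have "card {b. 0 < b \<and> b < e \<and> b mod 3 = 1} = card {0..<(e + 1) div 3}"
    by (rule bij_betw_same_card[symmetric])
  then show ?thesis using assms by simp
qed

text \<open>With floor division the expression of the positive case reappears with opposite sign, so
  that both merge into \<open>sgn_pair a e * ((e + 1) div 3)\<close>. For \<open>e\<close> congruent
  to 1 the endpoint \<open>e\<close> itself would be counted here.\<close>

lemma card_mod3_neg:
  fixes e :: int
  assumes "e mod 3 \<noteq> 1" "e < 0"
  shows "int (card {b. e < b \<and> b < 0 \<and> b mod 3 = 1}) = - ((e + 1) div 3)"
proof -
  have "bij_betw (\<lambda>j. 3 * j + 1) {(e + 1) div 3..<0} {b. e < b \<and> b < 0 \<and> b mod 3 = 1}"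
  proof (rule bij_betwI[where g = "\<lambda>b. b div 3"])
    show "(\<lambda>j. 3 * j + 1) \<in> {(e + 1) div 3..<0} \<rightarrow> {b. e < b \<and> b < 0 \<and> b mod 3 = 1}"
      using assms by (auto; presburger)
    show "(\<lambda>b. b div 3) \<in> {b. e < b \<and> b < 0 \<and> b mod 3 = 1} \<rightarrow> {(e + 1) div 3..<0}"
      using assms by (auto; presburger)
    show "3 * (b div 3) + 1 = b" if "b \<in> {b. e < b \<and> b < 0 \<and> b mod 3 = 1}" for b
      using that mult_div_mod_eq[of 3 b] by simp
  qed simp
  then have "card {b. e < b \<and> b < 0 \<and> b mod 3 = 1} = card {(e + 1) div 3..<0}"
    by (rule bij_betw_same_card[symmetric])
  moreover have "(e + 1) div 3 \<le> 0" using assms by presburger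
  ultimately show ?thesis by simp
qed

lemma mod3_add_eq:
  assumes "x mod 3 = s" "y mod 3 = t"
  shows "(x + y) mod (3::int) = (s + t) mod 3"
  using assms mod_add_eq[of x 3 y] by simp

lemma mod3_diff_eq_iff:
  assumes "y mod 3 = s" "0 \<le> t" "t < 3"
  shows "(x - y) mod (3::int) = t \<longleftrightarrow> x mod 3 = (s + t) mod 3"
proof -
  have "(x - y) mod 3 = t \<longleftrightarrow> (x - y) mod 3 = t mod 3" using assms by simp
  also have "\<dots> \<longleftrightarrow> x mod 3 = (y + t) mod 3" by (simp add: mod_eq_dvd_iff algebra_simps)
  also have "(y + t) mod 3 = (s + t) mod 3" using assms mod_add_left_eq[of y 3 t] by simp
  finally show ?thesis .
qed

lemma mod3_add_eq_1_iff: "a mod 3 = 1 \<Longrightarrow> (h + a) mod (3::int) = 1 \<longleftrightarrow> h mod 3 = 0"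
  by presburger

definition res_quads :: "int \<Rightarrow> int \<Rightarrow> int \<Rightarrow> int \<Rightarrow> int \<Rightarrow> (int \<times> int \<times> int \<times> int) set" where
  "res_quads N r1 r2 r3 r4 =
    {(a, b, c, d) \<in> quads N. a mod 3 = r1 \<and> b mod 3 = r2 \<and> c mod 3 = r3 \<and> d mod 3 = r4}"

definition res_divs :: "int \<Rightarrow> int \<Rightarrow> int \<Rightarrow> (int \<times> int) set" where
  "res_divs A r1 r2 = {(a, b) \<in> int_divs A. a mod 3 = r1 \<and> b mod 3 = r2}"

lemma finite_res_quads: "finite (res_quads N r1 r2 r3 r4)"
  by (rule finite_subset[OF _ finite_quads]) (auto simp: res_quads_def)

lemma finite_res_divs: "0 < A \<Longrightarrow> finite (res_divs A r1 r2)"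
  by (rule finite_subset[OF _ finite_int_divs]) (auto simp: res_divs_def)

lemma sum_res_quads_mult:
  "(\<Sum>(a, b, c, d)\<in>res_quads N r1 r2 r3 r4. f a b * g c d) =
   (\<Sum>A\<in>{0<..<N}. (\<Sum>(a, b)\<in>res_divs A r1 r2. f a b) * (\<Sum>(c, d)\<in>res_divs (N - A) r3 r4. (g c d :: int)))"
proof -
  define f' where "f' = (\<lambda>a b. if a mod 3 = r1 \<and> b mod 3 = r2 then f a b else 0)"
  define g' where "g' = (\<lambda>a b. if a mod 3 = r3 \<and> b mod 3 = r4 then g a b else 0)"
  have "(\<Sum>(a, b, c, d)\<in>res_quads N r1 r2 r3 r4. f a b * g c d) =
    (\<Sum>(a, b, c, d)\<in>quads N. f' a b * g' c d)"
    by (rule sum.mono_neutral_cong_left)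
      (auto simp: finite_quads res_quads_def f'_def g'_def split: if_splits)
  also have "\<dots> = (\<Sum>A\<in>{0<..<N}. (\<Sum>(a, b)\<in>int_divs A. f' a b) * (\<Sum>(c, d)\<in>int_divs (N - A). g' c d))"
    by (rule sum_quads_mult)
  also have "\<dots> = (\<Sum>A\<in>{0<..<N}. (\<Sum>(a, b)\<in>res_divs A r1 r2. f a b) * (\<Sum>(c, d)\<in>res_divs (N - A) r3 r4. g c d))"
  proof (rule sum.cong[OF refl])
    fix A assume A: "A \<in> {0<..<N}"
    have "(\<Sum>(a, b)\<in>int_divs A. f' a b) = (\<Sum>(a, b)\<in>res_divs A r1 r2. f a b)"
      by (rule sum.mono_neutral_cong_right) (use A in \<open>auto simp: finite_int_divs res_divs_def f'_def split: if_splits\<close>)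
    moreover have "(\<Sum>(c, d)\<in>int_divs (N - A). g' c d) = (\<Sum>(c, d)\<in>res_divs (N - A) r3 r4. g c d)"
      by (rule sum.mono_neutral_cong_right) (use A in \<open>auto simp: finite_int_divs res_divs_def g'_def split: if_splits\<close>)
    ultimately show "(\<Sum>(a, b)\<in>int_divs A. f' a b) * (\<Sum>(c, d)\<in>int_divs (N - A). g' c d) =
      (\<Sum>(a, b)\<in>res_divs A r1 r2. f a b) * (\<Sum>(c, d)\<in>res_divs (N - A) r3 r4. g c d)" by simp
  qed
  finally show ?thesis .
qed

text \<open>If \<open>a = c\<close>, then \<open>a * (b + d) = N\<close> and the two sign factors
  agree, so every term is just \<open>f e\<close> with \<open>e = b + d\<close>. The factor
  \<open>sgn_pair a e\<close> on the right arises from the number of ways to split \<open>e\<close>,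
  not from the summand.\<close>

lemma sum_diagonal:
  assumes N: "0 < N" and r: "r = 1 \<or> r = 2"
  shows "(\<Sum>(a, b, c, d) | (a, b, c, d) \<in> res_quads N 1 1 1 r \<and> a = c.
      sgn_pair a b * sgn_pair c d * f (b + d)) =
    (\<Sum>(a, e)\<in>res_divs N 1 ((1 + r) mod 3). sgn_pair a e * ((e + 1) div 3) * f e)"
proof -
  define B where "B = (\<lambda>(a::int, e::int). if 0 < e then {b. 0 < b \<and> b < e \<and> b mod 3 = 1}
    else {b. e < b \<and> b < 0 \<and> b mod 3 = 1})"
  have finB: "finite (B x)" for x
    by (cases x) (auto simp: B_def intro: finite_subset[of _ "{0..snd x}"] finite_subset[of _ "{snd x..0}"])
  have sgn_cases: "0 < a \<and> 0 < e \<or> a < 0 \<and> e < 0" if "a * e = N" for a e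
    using N that by (metis zero_less_mult_iff)
  let ?D = "res_divs N 1 ((1 + r) mod 3)"
  have "(\<Sum>(a, b, c, d) | (a, b, c, d) \<in> res_quads N 1 1 1 r \<and> a = c.
      sgn_pair a b * sgn_pair c d * f (b + d)) = (\<Sum>(x, b)\<in>Sigma ?D B. f (snd x))"
  proof (rule sum.reindex_bij_witness[where j = "\<lambda>(a, b, c, d). ((a, b + d), b)"
          and i = "\<lambda>(x, b). (fst x, b, fst x, snd x - b)"])
    fix q assume "q \<in> {(a, b, c, d). (a, b, c, d) \<in> res_quads N 1 1 1 r \<and> a = c}"
    then obtain a b d where q: "q = (a, b, a, d)" and Q: "(a, b, a, d) \<in> res_quads N 1 1 1 r" by auto
    then have *: "0 < a * b" "0 < a * d" "a * (b + d) = N" "a mod 3 = 1" "b mod 3 = 1" "d mod 3 = r"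
      unfolding res_quads_def quads_def by (simp_all add: distrib_left)
    have "(b + d) mod 3 = (1 + r) mod 3" using *(5,6) by (rule mod3_add_eq)
    then have "(a, b + d) \<in> ?D" using * by (simp add: res_divs_def int_divs_def)
    moreover have "b \<in> B (a, b + d)" using *(1,2,5) by (auto simp: B_def zero_less_mult_iff)
    ultimately show "(case q of (a, b, c, d) \<Rightarrow> ((a, b + d), b)) \<in> Sigma ?D B" by (simp add: q)
    show "(case case q of (a, b, c, d) \<Rightarrow> ((a, b + d), b) of (x, b) \<Rightarrow> (fst x, b, fst x, snd x - b)) = q"
      by (simp add: q)
    have "sgn_pair a b * sgn_pair a d = 1"
      using *(1,2) by (auto simp: sgn_pair_def zero_less_mult_iff)
    then show "(case case q of (a, b, c, d) \<Rightarrow> ((a, b + d), b) of (x, b) \<Rightarrow> f (snd x)) =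
      (case q of (a, b, c, d) \<Rightarrow> sgn_pair a b * sgn_pair c d * f (b + d))"
      by (simp add: q)
  next
    fix y assume "y \<in> Sigma ?D B"
    then obtain a e b where y: "y = ((a, e), b)" and D: "(a, e) \<in> ?D" and b: "b \<in> B (a, e)" by auto
    from D have ae: "a * e = N" "a mod 3 = 1" "e mod 3 = (1 + r) mod 3"
      unfolding res_divs_def int_divs_def by simp_all
    have b1: "b mod 3 = 1" using b by (auto simp: B_def split: if_splits)
    have "(e - b) mod 3 = r" using mod3_diff_eq_iff[OF b1, of r e] ae(3) r by auto
    moreover have "0 < a * b" "0 < a * (e - b)"
      using b sgn_cases[OF ae(1)] by (auto simp: B_def zero_less_mult_iff)
    ultimately show "(case y of (x, b) \<Rightarrow> (fst x, b, fst x, snd x - b)) \<in>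
      {(a, b, c, d). (a, b, c, d) \<in> res_quads N 1 1 1 r \<and> a = c}"
      using ae b1 by (simp add: y res_quads_def quads_def algebra_simps)
    show "(case case y of (x, b) \<Rightarrow> (fst x, b, fst x, snd x - b) of (a, b, c, d) \<Rightarrow> ((a, b + d), b)) = y"
      by (simp add: y)
  qed
  also have "\<dots> = (\<Sum>x\<in>?D. \<Sum>b\<in>B x. f (snd x))"
    by (rule sum.Sigma[symmetric]) (use finB N in \<open>auto simp: finite_res_divs\<close>)
  also have "\<dots> = (\<Sum>(a, e)\<in>?D. sgn_pair a e * ((e + 1) div 3) * f e)"
  proof (rule sum.cong[OF refl], clarify)
    fix a e assume "(a, e) \<in> ?D"
    then have ae: "a * e = N" "e mod 3 = (1 + r) mod 3"
      unfolding res_divs_def int_divs_def by simp_all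
    then have e: "e mod 3 \<noteq> 1" using r by auto
    have "int (card (B (a, e))) = sgn_pair a e * ((e + 1) div 3)"
      using sgn_cases[OF ae(1)] card_mod3_pos[OF e] card_mod3_neg[OF e]
      by (auto simp: B_def sgn_pair_def)
    then show "(\<Sum>b\<in>B (a, e). f (snd (a, e))) = sgn_pair a e * ((e + 1) div 3) * f e" by simp
  qed
  finally show ?thesis .
qed

text \<open>Both substitutions turn a weight in \<open>b + d\<close> into the same
  \<open>f e\<close>, and \<open>c - a\<close> and \<open>a - c\<close> have residue 0. The last two
  sums differ only in whether \<open>d\<close> or \<open>b\<close> is kept as the last entry. Terms
  with \<open>b + d = 0\<close> are outside the identity: residues exclude them for
  \<open>r = 1\<close>, and \<open>f 0 = 0\<close> removes them for \<open>r = 2\<close>.\<close>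

lemma sum_res_quads_fay:
  assumes N: "0 < N" and r: "r = 1 \<or> r = 2" and f0: "f 0 = 0 \<or> r = 1"
  shows "(\<Sum>(a, b, c, d)\<in>res_quads N 1 1 1 r. sgn_pair a b * sgn_pair c d * f (b + d)) =
    (\<Sum>(a, e)\<in>res_divs N 1 ((1 + r) mod 3). sgn_pair a e * ((e + 1) div 3) * f e) +
    (\<Sum>(a, e, h, d)\<in>res_quads N 1 ((1 + r) mod 3) 0 r. sgn_pair a e * sgn_pair h d * f e) +
    (\<Sum>(a, e, h, d)\<in>res_quads N 1 ((1 + r) mod 3) 0 1. sgn_pair a e * sgn_pair h d * f e)"
proof -
  \<comment> \<open>Putting the residue conditions into the weight carries them through the
    substitutions.\<close>
  define g where "g = (\<lambda>(a :: int) (b :: int) (c :: int) (d :: int). if a mod 3 = 1 \<and> b mod 3 = 1 \<and> c mod 3 = 1 \<and> d mod 3 = r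
    then f (b + d) else 0)"
  define F where "F = (\<lambda>(a, b, c, d). sgn_pair a b * sgn_pair c d * f (b + d))"
  let ?Q = "res_quads N 1 1 1 r"
  have sumsplit: "sum F ?Q = sum F {(a, b, c, d). (a, b, c, d) \<in> ?Q \<and> a = c} +
     sum F {(a, b, c, d). (a, b, c, d) \<in> ?Q \<and> a \<noteq> c}"
  proof -
    have "?Q = {(a, b, c, d). (a, b, c, d) \<in> ?Q \<and> a = c} \<union> {(a, b, c, d). (a, b, c, d) \<in> ?Q \<and> a \<noteq> c}"
      by auto
    moreover have "sum F ({(a, b, c, d). (a, b, c, d) \<in> ?Q \<and> a = c} \<union> {(a, b, c, d). (a, b, c, d) \<in> ?Q \<and> a \<noteq> c})
      = sum F {(a, b, c, d). (a, b, c, d) \<in> ?Q \<and> a = c} + sum F {(a, b, c, d). (a, b, c, d) \<in> ?Q \<and> a \<noteq> c}"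
      by (rule sum.union_disjoint) (auto intro: finite_subset[OF _ finite_res_quads[of N 1 1 1 r]])
    ultimately show ?thesis by simp
  qed
  have "sum F {(a, b, c, d). (a, b, c, d) \<in> ?Q \<and> a \<noteq> c} =
    (\<Sum>(a, b, c, d) | (a, b, c, d) \<in> quads N \<and> c \<noteq> a \<and> b + d \<noteq> 0.
      sgn_pair a b * sgn_pair c d * g a b c d)"
  proof (rule sum.mono_neutral_cong)
    show "finite {(a, b, c, d). (a, b, c, d) \<in> ?Q \<and> a \<noteq> c}"
      by (rule finite_subset[OF _ finite_res_quads[of N 1 1 1 r]]) auto
    show "finite {(a, b, c, d). (a, b, c, d) \<in> quads N \<and> c \<noteq> a \<and> b + d \<noteq> 0}"
      by (rule finite_subset[OF _ finite_quads[of N]]) auto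
    have "b + d \<noteq> 0" if "b mod 3 = 1" "d mod 3 = 1" for b d :: int
      using that by presburger
    then show "F x = 0" if "x \<in> {(a, b, c, d). (a, b, c, d) \<in> ?Q \<and> a \<noteq> c} -
      {(a, b, c, d). (a, b, c, d) \<in> quads N \<and> c \<noteq> a \<and> b + d \<noteq> 0}" for x
      using that f0 by (auto simp: F_def res_quads_def)
  qed (auto simp: F_def g_def res_quads_def split: if_splits)
  also have "\<dots> = (\<Sum>(a, e, h, d) | (a, e, h, d) \<in> quads N \<and> e \<noteq> d \<and> h + a \<noteq> 0.
      sgn_pair a e * sgn_pair h d * g a (e - d) (h + a) d) +
    (\<Sum>(c, e, k, b) | (c, e, k, b) \<in> quads N \<and> e \<noteq> b \<and> k + c \<noteq> 0.
      sgn_pair c e * sgn_pair k b * g (k + c) b c (e - b))"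
    by (rule sum_quads_fay)
  also have "(\<Sum>(a, e, h, d) | (a, e, h, d) \<in> quads N \<and> e \<noteq> d \<and> h + a \<noteq> 0.
      sgn_pair a e * sgn_pair h d * g a (e - d) (h + a) d) =
    (\<Sum>(a, e, h, d)\<in>res_quads N 1 ((1 + r) mod 3) 0 r. sgn_pair a e * sgn_pair h d * f e)"
  proof (rule sum.mono_neutral_cong_right)
    show "finite {(a, e, h, d). (a, e, h, d) \<in> quads N \<and> e \<noteq> d \<and> h + a \<noteq> 0}"
      by (rule finite_subset[OF _ finite_quads[of N]]) auto
    have 1: "e \<noteq> d" if "e mod 3 = (1 + r) mod 3" "d mod 3 = r" for e d :: int using that r by auto
    have 2: "h + a \<noteq> 0" if "h mod 3 = 0" "a mod 3 = 1" for h a :: int using that by presburger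
    show "res_quads N 1 ((1 + r) mod 3) 0 r \<subseteq> {(a, e, h, d). (a, e, h, d) \<in> quads N \<and> e \<noteq> d \<and> h + a \<noteq> 0}"
    proof
      fix x assume "x \<in> res_quads N 1 ((1 + r) mod 3) 0 r"
      then obtain a e h d where "x = (a, e, h, d)" "(a, e, h, d) \<in> quads N" "a mod 3 = 1"
        "e mod 3 = (1 + r) mod 3" "h mod 3 = 0" "d mod 3 = r"
        by (cases x) (auto simp: res_quads_def)
      then show "x \<in> {(a, e, h, d). (a, e, h, d) \<in> quads N \<and> e \<noteq> d \<and> h + a \<noteq> 0}"
        using 1[of e d] 2[of h a] by simp
    qed
    have 3: "a mod 3 = 1 \<and> (e - d) mod 3 = 1 \<and> (h + a) mod 3 = 1 \<and> d mod 3 = r \<longleftrightarrow>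
      a mod 3 = 1 \<and> e mod 3 = (1 + r) mod 3 \<and> h mod 3 = 0 \<and> d mod 3 = r" for a e h d :: int
      using mod3_diff_eq_iff[of d r 1 e] mod3_add_eq_1_iff[of a h] by (auto simp: add.commute)
    have g: "g a (e - d) (h + a) d = (if (a, e, h, d) \<in> res_quads N 1 ((1 + r) mod 3) 0 r then f e else 0)"
      if "(a, e, h, d) \<in> quads N" for a e h d
      using that unfolding g_def 3 by (simp add: res_quads_def)
    show "\<forall>x\<in>{(a, e, h, d). (a, e, h, d) \<in> quads N \<and> e \<noteq> d \<and> h + a \<noteq> 0} - res_quads N 1 ((1 + r) mod 3) 0 r.
      (case x of (a, e, h, d) \<Rightarrow> sgn_pair a e * sgn_pair h d * g a (e - d) (h + a) d) = 0"
      by (auto simp: g)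
    show "(case x of (a, e, h, d) \<Rightarrow> sgn_pair a e * sgn_pair h d * g a (e - d) (h + a) d) =
      (case x of (a, e, h, d) \<Rightarrow> sgn_pair a e * sgn_pair h d * f e)"
      if "x \<in> res_quads N 1 ((1 + r) mod 3) 0 r" for x
    proof -
      obtain a e h d where x: "x = (a, e, h, d)" by (metis prod_cases4)
      moreover have "x \<in> quads N" using that x by (simp add: res_quads_def)
      ultimately show ?thesis using that by (simp add: g)
    qed
  qed
  also have "(\<Sum>(c, e, k, b) | (c, e, k, b) \<in> quads N \<and> e \<noteq> b \<and> k + c \<noteq> 0.
      sgn_pair c e * sgn_pair k b * g (k + c) b c (e - b)) =
    (\<Sum>(a, e, h, d)\<in>res_quads N 1 ((1 + r) mod 3) 0 1. sgn_pair a e * sgn_pair h d * f e)"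
  proof (rule sum.mono_neutral_cong_right)
    show "finite {(a, e, h, d). (a, e, h, d) \<in> quads N \<and> e \<noteq> d \<and> h + a \<noteq> 0}"
      by (rule finite_subset[OF _ finite_quads[of N]]) auto
    have 1: "e \<noteq> d" if "e mod 3 = (1 + r) mod 3" "d mod 3 = 1" for e d :: int using that r by auto
    have 2: "h + a \<noteq> 0" if "h mod 3 = 0" "a mod 3 = 1" for h a :: int using that by presburger
    show "res_quads N 1 ((1 + r) mod 3) 0 1 \<subseteq> {(a, e, h, d). (a, e, h, d) \<in> quads N \<and> e \<noteq> d \<and> h + a \<noteq> 0}"
    proof
      fix x assume "x \<in> res_quads N 1 ((1 + r) mod 3) 0 1"
      then obtain a e h d where "x = (a, e, h, d)" "(a, e, h, d) \<in> quads N" "a mod 3 = 1"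
        "e mod 3 = (1 + r) mod 3" "h mod 3 = 0" "d mod 3 = 1"
        by (cases x) (auto simp: res_quads_def)
      then show "x \<in> {(a, e, h, d). (a, e, h, d) \<in> quads N \<and> e \<noteq> d \<and> h + a \<noteq> 0}"
        using 1[of e d] 2[of h a] by simp
    qed
    have 3: "(k + c) mod 3 = 1 \<and> b mod 3 = 1 \<and> c mod 3 = 1 \<and> (e - b) mod 3 = r \<longleftrightarrow>
      c mod 3 = 1 \<and> e mod 3 = (1 + r) mod 3 \<and> k mod 3 = 0 \<and> b mod 3 = 1" for c e k b :: int
      using mod3_diff_eq_iff[of b 1 r e] mod3_add_eq_1_iff[of c k] r by auto
    have g: "g (k + c) b c (e - b) = (if (c, e, k, b) \<in> res_quads N 1 ((1 + r) mod 3) 0 1 then f e else 0)"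
      if "(c, e, k, b) \<in> quads N" for c e k b
      using that unfolding g_def 3 by (simp add: res_quads_def)
    show "\<forall>x\<in>{(a, e, h, d). (a, e, h, d) \<in> quads N \<and> e \<noteq> d \<and> h + a \<noteq> 0} - res_quads N 1 ((1 + r) mod 3) 0 1.
      (case x of (c, e, k, b) \<Rightarrow> sgn_pair c e * sgn_pair k b * g (k + c) b c (e - b)) = 0"
      by (auto simp: g)
    show "(case x of (c, e, k, b) \<Rightarrow> sgn_pair c e * sgn_pair k b * g (k + c) b c (e - b)) =
      (case x of (a, e, h, d) \<Rightarrow> sgn_pair a e * sgn_pair h d * f e)"
      if "x \<in> res_quads N 1 ((1 + r) mod 3) 0 1" for x
    proof -
      obtain c e k b where x: "x = (c, e, k, b)" by (metis prod_cases4)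
      moreover have "x \<in> quads N" using that x by (simp add: res_quads_def)
      ultimately show ?thesis using that by (simp add: g)
    qed
  qed
  finally show ?thesis
    using sumsplit sum_diagonal[OF N r, of f] unfolding F_def by linarith
qed

section \<open>Evaluation of the double and the triple convolution\<close>

text \<open>The involution sending \<open>(a, b)\<close> to \<open>(- b, - a)\<close> preserves the
  product and the residues 1 and 2 in this order, but reverses the sign.\<close>

lemma sum_sgn_pair_res_divs_1_2: "(\<Sum>(a, b)\<in>res_divs A 1 2. sgn_pair a b) = 0"
proof -
  have "(- b) mod 3 = 1 \<longleftrightarrow> b mod 3 = 2" "(- b) mod 3 = 2 \<longleftrightarrow> b mod 3 = 1" for b :: int by presburger+
  then have "(\<Sum>(a, b)\<in>res_divs A 1 2. sgn_pair a b) = (\<Sum>(a, b)\<in>res_divs A 1 2. - sgn_pair a b)"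
    by (intro sum.reindex_bij_witness[where i = "\<lambda>(a, b). (- b, - a)" and j = "\<lambda>(a, b). (- b, - a)"])
      (auto simp: res_divs_def int_divs_def sgn_pair_minus sgn_pair_commute mult.commute)
  then show ?thesis by (simp add: case_prod_beta sum_negf)
qed

definition class1_sum :: "int \<Rightarrow> int" where
  "class1_sum A = (\<Sum>(a, b)\<in>res_divs A 1 1. sgn_pair a b)"

text \<open>With constant weight and \<open>r = 1\<close> both off-diagonal sums factor and contain
  the vanishing sum over residues 1 and 2. The same vanishing reduces the diagonal weight
  \<open>3 * ((e + 1) div 3) = e + 1\<close> to \<open>e\<close>.\<close>

lemma convolution_2:
  assumes "0 < N"
  shows "3 * (\<Sum>A\<in>{0<..<N}. class1_sum A * class1_sum (N - A)) =
    (\<Sum>(a, e)\<in>res_divs N 1 2. sgn_pair a e * e)"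
proof -
  have van: "(\<Sum>(a, e, h, d)\<in>res_quads N 1 2 0 r. sgn_pair a e * sgn_pair h d) = 0" for r
    unfolding sum_res_quads_mult sum_sgn_pair_res_divs_1_2 by simp
  have "(\<Sum>A\<in>{0<..<N}. class1_sum A * class1_sum (N - A)) =
    (\<Sum>(a, b, c, d)\<in>res_quads N 1 1 1 1. sgn_pair a b * sgn_pair c d)"
    unfolding sum_res_quads_mult class1_sum_def ..
  also have "\<dots> = (\<Sum>(a, e)\<in>res_divs N 1 2. sgn_pair a e * ((e + 1) div 3))"
    using sum_res_quads_fay[OF assms, of 1 "\<lambda>_. 1"] by (simp add: van)
  finally have "3 * (\<Sum>A\<in>{0<..<N}. class1_sum A * class1_sum (N - A)) =
    (\<Sum>(a, e)\<in>res_divs N 1 2. sgn_pair a e * (3 * ((e + 1) div 3)))"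
    by (simp add: sum_distrib_left case_prod_beta mult.left_commute)
  also have "\<dots> = (\<Sum>(a, e)\<in>res_divs N 1 2. sgn_pair a e * e + sgn_pair a e)"
  proof (rule sum.cong[OF refl], clarify)
    fix a e assume "(a, e) \<in> res_divs N 1 2"
    then have "e mod 3 = 2" by (simp add: res_divs_def)
    then have "3 * ((e + 1) div 3) = e + 1" by presburger
    then show "sgn_pair a e * (3 * ((e + 1) div 3)) = sgn_pair a e * e + sgn_pair a e"
      by (simp add: algebra_simps)
  qed
  also have "\<dots> = (\<Sum>(a, e)\<in>res_divs N 1 2. sgn_pair a e * e)"
    using sum_sgn_pair_res_divs_1_2[of N] by (simp add: case_prod_beta sum.distrib)
  finally show ?thesis .
qed

text \<open>The given weight is \<open>d\<close> alone, but adding \<open>b\<close> costs nothing: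
  that part factors and contains the vanishing sum over \<open>c\<close> and \<open>d\<close>. The
  weight \<open>b + d\<close> then passes through the substitutions, and the two off-diagonal sums,
  with last residues 2 and 1, cancel on negating \<open>h\<close> and \<open>d\<close>.\<close>

lemma convolution_3:
  assumes "0 < N"
  shows "(\<Sum>A\<in>{0<..<N}. class1_sum A * (\<Sum>(c, d)\<in>res_divs (N - A) 1 2. sgn_pair c d * d)) =
    (\<Sum>(a, e)\<in>res_divs N 1 0. sgn_pair a e * (e div 3) * e)"
proof -
  let ?Q = "res_quads N 1 1 1 2"
  have neg: "(- d) mod 3 = 1 \<longleftrightarrow> d mod 3 = 2" "(- d) mod 3 = 2 \<longleftrightarrow> d mod 3 = 1"
    "(- d) mod 3 = 0 \<longleftrightarrow> d mod 3 = 0" for d :: int by presburger+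
  have van: "(\<Sum>(a, b, c, d)\<in>?Q. (sgn_pair a b * b) * sgn_pair c d) = 0"
    unfolding sum_res_quads_mult sum_sgn_pair_res_divs_1_2 by simp
  have "(\<Sum>(a, e, h, d)\<in>res_quads N 1 0 0 2. sgn_pair a e * sgn_pair h d * e) =
    (\<Sum>(a, e, h, d)\<in>res_quads N 1 0 0 1. - (sgn_pair a e * sgn_pair h d * e))"
    by (rule sum.reindex_bij_witness[where i = "\<lambda>(a, e, h, d). (a, e, - h, - d)"
          and j = "\<lambda>(a, e, h, d). (a, e, - h, - d)"])
      (auto simp: res_quads_def quads_def sgn_pair_minus neg)
  then have cancel: "(\<Sum>(a, e, h, d)\<in>res_quads N 1 0 0 2. sgn_pair a e * sgn_pair h d * e) =
    - (\<Sum>(a, e, h, d)\<in>res_quads N 1 0 0 1. sgn_pair a e * sgn_pair h d * e)"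
    by (simp add: case_prod_beta sum_negf)
  have "(\<Sum>A\<in>{0<..<N}. class1_sum A * (\<Sum>(c, d)\<in>res_divs (N - A) 1 2. sgn_pair c d * d)) =
    (\<Sum>(a, b, c, d)\<in>?Q. sgn_pair a b * (sgn_pair c d * d))"
    unfolding sum_res_quads_mult class1_sum_def ..
  also have "\<dots> = (\<Sum>(a, b, c, d)\<in>?Q. sgn_pair a b * (sgn_pair c d * d)) +
      (\<Sum>(a, b, c, d)\<in>?Q. (sgn_pair a b * b) * sgn_pair c d)"
    using van by simp
  also have "\<dots> = (\<Sum>(a, b, c, d)\<in>?Q. sgn_pair a b * sgn_pair c d * (b + d))"
    unfolding sum.distrib[symmetric] by (intro sum.cong refl) (auto simp: algebra_simps)
  also have "\<dots> = (\<Sum>(a, e)\<in>res_divs N 1 0. sgn_pair a e * ((e + 1) div 3) * e)"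
    using sum_res_quads_fay[OF assms, of 2 "\<lambda>x. x"] cancel by simp
  also have "\<dots> = (\<Sum>(a, e)\<in>res_divs N 1 0. sgn_pair a e * (e div 3) * e)"
  proof (rule sum.cong[OF refl], clarify)
    fix a e assume "(a, e) \<in> res_divs N 1 0"
    then have "e mod 3 = 0" by (simp add: res_divs_def)
    then have "(e + 1) div 3 = e div 3" by presburger
    then show "sgn_pair a e * ((e + 1) div 3) * e = sgn_pair a e * (e div 3) * e" by simp
  qed
  finally show ?thesis .
qed

section \<open>From signed factorisations to divisor sums with the character\<close>

lemma sum_int_divs_chi3:
  fixes f :: "nat \<Rightarrow> int"
  assumes "0 < N"
  shows "(\<Sum>(a, b) | (a, b) \<in> int_divs (int N) \<and> a mod 3 = 1. sgn_pair a b * f (nat \<bar>b\<bar>)) =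
    (\<Sum>d | d dvd N. chi3 d * f (N div d))"
proof -
  let ?D = "{d. d dvd N \<and> d mod 3 \<noteq> 0}"
  define j where "j = (\<lambda>(a :: int, b :: int). nat \<bar>a\<bar>)"
  \<comment> \<open>For \<open>d\<close> prime to 3, exactly one of \<open>d\<close> and
    \<open>- d\<close> is congruent to 1, and the sign of that one is \<open>chi3 d\<close>.\<close>
  define i where "i = (\<lambda>d. if d mod 3 = 1 then (int d, int (N div d)) else (- int d, - int (N div d)))"
  have "(\<Sum>(a, b) | (a, b) \<in> int_divs (int N) \<and> a mod 3 = 1. sgn_pair a b * f (nat \<bar>b\<bar>)) =
    (\<Sum>d\<in>?D. chi3 d * f (N div d))"
  proof (rule sum.reindex_bij_witness[where j = j and i = i])
    fix x assume "x \<in> {(a, b). (a, b) \<in> int_divs (int N) \<and> a mod 3 = 1}"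
    then obtain a b where x: "x = (a, b)" and ab: "a * b = int N" "a mod 3 = 1"
      by (auto simp: int_divs_def)
    define d e where "d = nat \<bar>a\<bar>" and "e = nat \<bar>b\<bar>"
    have jx: "j x = d" by (simp add: j_def d_def x)
    have "int d * int e = \<bar>a * b\<bar>" by (simp add: d_def e_def abs_mult)
    then have "int (d * e) = int N" using ab(1) by simp
    then have de: "N = d * e" by (simp only: of_nat_eq_iff)
    then have d0: "0 < d" using assms by (auto intro: gr0I)
    have ediv: "N div d = e" using de d0 by simp
    have "0 < a * b" using ab(1) assms by simp
    then consider "a = int d" "b = int e" "0 < a" "0 < b" | "a = - int d" "b = - int e" "a < 0" "b < 0"
      unfolding zero_less_mult_iff d_def e_def by fastforce
    then have "i d = (a, b) \<and> d \<in> ?D \<and> sgn_pair a b = chi3 d"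
    proof cases
      case 1
      then have "d mod 3 = 1" using ab(2) by presburger
      then show ?thesis using 1 ediv de by (simp add: sgn_pair_def chi3_def i_def)
    next
      case 2
      then have "d mod 3 = 2" using ab(2) by presburger
      then show ?thesis using 2 ediv de by (simp add: sgn_pair_def chi3_def i_def)
    qed
    then show "i (j x) = x" "j x \<in> ?D"
      "chi3 (j x) * f (N div j x) = (case x of (a, b) \<Rightarrow> sgn_pair a b * f (nat \<bar>b\<bar>))"
      unfolding jx ediv by (simp_all add: x e_def)
  next
    fix d assume d: "d \<in> ?D"
    have "d mod 3 < 3" by simp
    then have "d mod 3 = 1 \<or> d mod 3 = 2" using d by (simp, linarith)
    moreover have "int d * int (N div d) = int N" using d by (simp flip: of_nat_mult)
    moreover have "int d mod 3 = 1" if "d mod 3 = 1" using that by presburger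
    moreover have "(- int d) mod 3 = 1" if "d mod 3 = 2" using that by presburger
    ultimately show "i d \<in> {(a, b). (a, b) \<in> int_divs (int N) \<and> a mod 3 = 1}"
      by (auto simp: int_divs_def i_def)
    show "j (i d) = d" by (simp add: i_def j_def)
  qed
  also have "\<dots> = (\<Sum>d | d dvd N. chi3 d * f (N div d))"
    by (rule sum.mono_neutral_left) (use assms in \<open>auto simp: chi3_def\<close>)
  finally show ?thesis .
qed

lemma class1_sum_chi3: "class1_sum (int (3 * i + 1)) = chi3_sum (3 * i + 1)"
proof -
  have "b mod 3 = 1" if "a * b = int (3 * i + 1)" "a mod 3 = 1" for a b
  proof -
    have "(a * b) mod 3 = ((a mod 3) * b) mod 3" by (simp add: mod_mult_left_eq)
    then have "b mod 3 = int (3 * i + 1) mod 3" using that by simp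
    also have "\<dots> = 1" by presburger
    finally show ?thesis .
  qed
  then have "res_divs (int (3 * i + 1)) 1 1 = {(a, b). (a, b) \<in> int_divs (int (3 * i + 1)) \<and> a mod 3 = 1}"
    unfolding res_divs_def int_divs_def by blast
  then show ?thesis
    using sum_int_divs_chi3[of "3 * i + 1" "\<lambda>_. 1"]
    by (simp add: class1_sum_def chi3_sum_def)
qed

lemma class1_sum_eq_0: "A mod 3 \<noteq> 1 \<Longrightarrow> class1_sum A = 0"
proof -
  assume A: "A mod 3 \<noteq> 1"
  have "(a * b) mod 3 = 1" if "a mod 3 = 1" "b mod 3 = 1" for a b :: int
    using that mod_mult_eq[of a 3 b] by simp
  then have "res_divs A 1 1 = {}" using A by (auto simp: res_divs_def int_divs_def)
  then show ?thesis by (simp add: class1_sum_def)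
qed

text \<open>The bounds on \<open>N\<close> admit both totals \<open>3 * n + 2\<close> and
  \<open>3 * n + 3\<close>; in either case the contributing arguments are 1, 4, ...,
  \<open>3 * n + 1\<close>.\<close>

lemma sum_class1:
  assumes "\<And>A. A mod 3 \<noteq> 1 \<Longrightarrow> f A = 0" and N: "3 * int n + 1 < N" "N \<le> 3 * int n + 4"
  shows "(\<Sum>A\<in>{0<..<N}. f A) = (\<Sum>i\<le>n. f (int (3 * i + 1)))"
proof -
  have "(\<Sum>i\<le>n. f (int (3 * i + 1))) = sum f ((\<lambda>i. int (3 * i + 1)) ` {..n})"
    by (simp add: sum.reindex inj_on_def)
  also have "\<dots> = (\<Sum>A\<in>{0<..<N}. f A)"
  proof (rule sum.mono_neutral_left)
    show "\<forall>A\<in>{0<..<N} - (\<lambda>i. int (3 * i + 1)) ` {..n}. f A = 0"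
    proof
      fix A assume A: "A \<in> {0<..<N} - (\<lambda>i. int (3 * i + 1)) ` {..n}"
      have "A mod 3 \<noteq> 1"
      proof
        assume "A mod 3 = 1"
        moreover have "0 < A" "A \<le> 3 * int n + 3" using A N by auto
        ultimately have "0 \<le> A div 3" "3 * (A div 3) + 1 = A" "A div 3 \<le> int n" by presburger+
        then have "A = int (3 * nat (A div 3) + 1)" "nat (A div 3) \<le> n" by auto
        then show False using A by blast
      qed
      then show "f A = 0" by (rule assms(1))
    qed
  qed (use N in auto)
  finally show ?thesis ..
qed

definition core_count :: "nat \<Rightarrow> int" where
  "core_count n = chi3_sum (3 * n + 1)"

lemma core_count_convolution_2:
  "3 * (\<Sum>i\<le>n. core_count i * core_count (n - i)) =
    (\<Sum>(a, e)\<in>res_divs (int (3 * n + 2)) 1 2. sgn_pair a e * e)"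
proof -
  have "(\<Sum>A\<in>{0<..<int (3 * n + 2)}. class1_sum A * class1_sum (int (3 * n + 2) - A)) =
    (\<Sum>i\<le>n. class1_sum (int (3 * i + 1)) * class1_sum (int (3 * n + 2) - int (3 * i + 1)))"
    by (rule sum_class1) (auto simp: class1_sum_eq_0)
  also have "\<dots> = (\<Sum>i\<le>n. core_count i * core_count (n - i))"
  proof (rule sum.cong[OF refl])
    fix i assume "i \<in> {..n}"
    then have "int (3 * n + 2) - int (3 * i + 1) = int (3 * (n - i) + 1)" by auto
    then show "class1_sum (int (3 * i + 1)) * class1_sum (int (3 * n + 2) - int (3 * i + 1)) =
      core_count i * core_count (n - i)"
      by (simp only: class1_sum_chi3 core_count_def)
  qed
  finally show ?thesis using convolution_2[of "int (3 * n + 2)"] by simp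
qed

definition chi3_square_sum :: "nat \<Rightarrow> int" where
  "chi3_square_sum N = (\<Sum>d | d dvd N. chi3 d * int ((N div d)\<^sup>2))"

text \<open>The factor 3 from the double convolution cancels against the one in
  \<open>(e div 3) * e = 3 * b^2\<close>, where \<open>e = 3 * b\<close> and
  \<open>a * b = n + 1\<close>.\<close>

lemma core_count_convolution_3:
  "(\<Sum>i\<le>n. core_count i * (\<Sum>j\<le>n - i. core_count j * core_count (n - i - j))) =
    chi3_square_sum (n + 1)"
proof -
  let ?N = "int (3 * n + 3)"
  define T where "T = (\<lambda>A. \<Sum>(c, d)\<in>res_divs A 1 2. sgn_pair c d * d)"
  have "(\<Sum>A\<in>{0<..<?N}. class1_sum A * T (?N - A)) =
    (\<Sum>i\<le>n. class1_sum (int (3 * i + 1)) * T (?N - int (3 * i + 1)))"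
    by (rule sum_class1) (auto simp: class1_sum_eq_0)
  also have "\<dots> = (\<Sum>i\<le>n. 3 * (core_count i * (\<Sum>j\<le>n - i. core_count j * core_count (n - i - j))))"
  proof (rule sum.cong[OF refl])
    fix i assume "i \<in> {..n}"
    then have "?N - int (3 * i + 1) = int (3 * (n - i) + 2)" by auto
    then have "T (?N - int (3 * i + 1)) = T (int (3 * (n - i) + 2))" by (rule arg_cong)
    also have "\<dots> = 3 * (\<Sum>j\<le>n - i. core_count j * core_count (n - i - j))"
      unfolding T_def by (rule core_count_convolution_2[symmetric])
    finally have "T (?N - int (3 * i + 1)) = 3 * (\<Sum>j\<le>n - i. core_count j * core_count (n - i - j))" .
    then show "class1_sum (int (3 * i + 1)) * T (?N - int (3 * i + 1)) =
      3 * (core_count i * (\<Sum>j\<le>n - i. core_count j * core_count (n - i - j)))"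
      by (simp only: class1_sum_chi3 core_count_def mult.left_commute)
  qed
  finally have 1: "(\<Sum>A\<in>{0<..<?N}. class1_sum A * T (?N - A)) =
    3 * (\<Sum>i\<le>n. core_count i * (\<Sum>j\<le>n - i. core_count j * core_count (n - i - j)))"
    by (simp add: sum_distrib_left)
  have "(\<Sum>(a, e)\<in>res_divs ?N 1 0. sgn_pair a e * (e div 3) * e) =
    (\<Sum>(a, b) | (a, b) \<in> int_divs (int (n + 1)) \<and> a mod 3 = 1. 3 * (sgn_pair a b * int ((nat \<bar>b\<bar>)\<^sup>2)))"
  proof (rule sum.reindex_bij_witness[where j = "\<lambda>(a, e). (a, e div 3)" and i = "\<lambda>(a, b). (a, 3 * b)"])
    fix x assume "x \<in> res_divs ?N 1 0"
    then obtain a b where x: "x = (a, 3 * b)" and ab: "a * (3 * b) = ?N" "a mod 3 = 1"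
      by (auto simp: res_divs_def int_divs_def mod_eq_0_iff_dvd elim!: dvdE)
    have "sgn_pair a (3 * b) = sgn_pair a b" by (simp add: sgn_pair_def)
    then show "(case x of (a, e) \<Rightarrow> (a, e div 3)) \<in> {(a, b). (a, b) \<in> int_divs (int (n + 1)) \<and> a mod 3 = 1}"
      "(case case x of (a, e) \<Rightarrow> (a, e div 3) of (a, b) \<Rightarrow> (a, 3 * b)) = x"
      "(case case x of (a, e) \<Rightarrow> (a, e div 3) of (a, b) \<Rightarrow> 3 * (sgn_pair a b * int ((nat \<bar>b\<bar>)\<^sup>2))) =
        (case x of (a, e) \<Rightarrow> sgn_pair a e * (e div 3) * e)"
      using ab by (simp_all add: x int_divs_def power2_eq_square)
  qed (auto simp: res_divs_def int_divs_def)
  also have "\<dots> = 3 * (\<Sum>(a, b) | (a, b) \<in> int_divs (int (n + 1)) \<and> a mod 3 = 1. sgn_pair a b * int ((nat \<bar>b\<bar>)\<^sup>2))"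
    by (simp add: sum_distrib_left case_prod_beta)
  also have "\<dots> = 3 * chi3_square_sum (n + 1)"
    using sum_int_divs_chi3[of "n + 1" "\<lambda>m. int (m\<^sup>2)"] by (simp add: chi3_square_sum_def)
  finally show ?thesis using 1 convolution_3[of ?N] unfolding T_def by simp
qed

subsection \<open>Multiplicativity and the count of triples\<close>

text \<open>Divisors of \<open>p ^ k * m\<close> are uniquely of the form \<open>p ^ i * e\<close>
  with \<open>e\<close> dividing \<open>m\<close>, and the summand is multiplicative in this
  splitting.\<close>

lemma chi3_square_sum_prime_power_mult:
  assumes p: "prime p" and m: "0 < m" "\<not> p dvd m"
  shows "chi3_square_sum (p ^ k * m) = (\<Sum>i\<le>k. chi3 p ^ i * (int p)\<^sup>2 ^ (k - i)) * chi3_square_sum m"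
proof -
  have p0: "0 < p" using p prime_gt_0_nat by blast
  have chi_pow: "chi3 (p ^ i) = chi3 p ^ i" for i
    by (induction i) (simp_all add: chi3_mult chi3_def[of "Suc 0"])
  have mult: "multiplicity p (p ^ i * e) = i" if "e dvd m" for i e
  proof (rule multiplicity_decomposeI)
    show "\<not> p dvd e" using that m(2) dvd_trans by blast
  qed (use p0 in auto)
  have "chi3_square_sum (p ^ k * m) =
    (\<Sum>(i, e)\<in>{..k} \<times> {e. e dvd m}. chi3 (p ^ i * e) * int ((p ^ k * m div (p ^ i * e))\<^sup>2))"
    unfolding chi3_square_sum_def
  proof (rule sum.reindex_bij_witness[where i = "\<lambda>(i, e). p ^ i * e"
        and j = "\<lambda>d. (multiplicity p d, d div p ^ multiplicity p d)"])
    fix d assume d: "d \<in> {d. d dvd p ^ k * m}"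
    then have "d dvd p ^ k * m" by simp
    then obtain x e where xe: "d = x * e" "x dvd p ^ k" "e dvd m" by (rule dvd_productE)
    then obtain i where i: "i \<le> k" "x = p ^ i" using divides_primepow_nat p by blast
    have mi: "multiplicity p d = i" using mult xe i by simp
    have de: "d div p ^ i = e" using xe i p0 by simp
    show "(case (multiplicity p d, d div p ^ multiplicity p d) of (i, e) \<Rightarrow> p ^ i * e) = d"
      using xe i mi de by simp
    show "(multiplicity p d, d div p ^ multiplicity p d) \<in> {..k} \<times> {e. e dvd m}"
      using xe i mi de by simp
    show "(case (multiplicity p d, d div p ^ multiplicity p d) of
        (i, e) \<Rightarrow> chi3 (p ^ i * e) * int ((p ^ k * m div (p ^ i * e))\<^sup>2)) =
      chi3 d * int ((p ^ k * m div d)\<^sup>2)"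
      using xe i mi de by simp
  next
    fix y assume "y \<in> {..k} \<times> {e. e dvd m}"
    then obtain i e where y: "y = (i, e)" "i \<le> k" "e dvd m" by auto
    show "(multiplicity p (case y of (i, e) \<Rightarrow> p ^ i * e),
        (case y of (i, e) \<Rightarrow> p ^ i * e) div p ^ multiplicity p (case y of (i, e) \<Rightarrow> p ^ i * e)) = y"
      using y mult[of e i] p0 by simp
    show "(case y of (i, e) \<Rightarrow> p ^ i * e) \<in> {d. d dvd p ^ k * m}"
      using y by (simp add: mult_dvd_mono le_imp_power_dvd)
  qed
  also have "\<dots> = (\<Sum>(i, e)\<in>{..k} \<times> {e. e dvd m}.
      (chi3 p ^ i * (int p)\<^sup>2 ^ (k - i)) * (chi3 e * int ((m div e)\<^sup>2)))"
  proof (rule sum.cong[OF refl], clarify)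
    fix i e assume "i \<le> k" "e dvd m"
    then obtain f where f: "m = e * f" by (elim dvdE)
    then have e0: "0 < e" using m by (auto intro: gr0I)
    have "p ^ k = p ^ i * p ^ (k - i)" using \<open>i \<le> k\<close> by (simp flip: power_add)
    then have "p ^ k * m = (p ^ i * e) * (p ^ (k - i) * f)" by (simp add: f)
    then have "p ^ k * m div (p ^ i * e) = p ^ (k - i) * f" using p0 e0 by simp
    also have "f = m div e" using f e0 by simp
    finally have "p ^ k * m div (p ^ i * e) = p ^ (k - i) * (m div e)" .
    then show "chi3 (p ^ i * e) * int ((p ^ k * m div (p ^ i * e))\<^sup>2) =
      (chi3 p ^ i * (int p)\<^sup>2 ^ (k - i)) * (chi3 e * int ((m div e)\<^sup>2))"
      by (simp add: chi3_mult chi_pow power_mult_distrib flip: power_mult) (simp add: mult.commute)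
  qed
  also have "\<dots> = (\<Sum>i\<le>k. chi3 p ^ i * (int p)\<^sup>2 ^ (k - i)) * chi3_square_sum m"
    unfolding chi3_square_sum_def by (simp add: sum_product sum.cartesian_product)
  finally show ?thesis .
qed

text \<open>The closed form of the geometric sum of \<open>chi3 p ^ i * p ^ (2 * (k - i))\<close>
  over \<open>i \<le> k\<close>, for the three values of the character. Among primes, the last case
  is \<open>p = 3\<close>, where only \<open>i = 0\<close> contributes.\<close>

definition local_factor :: "nat \<Rightarrow> nat \<Rightarrow> real" where
  "local_factor p k =
    (if p mod 3 = 1 then (real p ^ (2 * (k + 1)) - 1) / (real p ^ 2 - 1)
     else if p mod 3 = 2 then (real p ^ (2 * k + 2) + (-1) ^ k) / (real p ^ 2 + 1)
     else real p ^ (2 * k))"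

lemma geometric_sum_mult:
  fixes x c :: "'a :: comm_ring_1"
  shows "(\<Sum>i\<le>k. c ^ i * x ^ (k - i)) * (x - c) = x ^ Suc k - c ^ Suc k"
proof (induction k)
  case (Suc k)
  have "(\<Sum>i\<le>Suc k. c ^ i * x ^ (Suc k - i)) = x * (\<Sum>i\<le>k. c ^ i * x ^ (k - i)) + c ^ Suc k"
    by (simp add: sum_distrib_left Suc_diff_le mult.left_commute)
  then have "(\<Sum>i\<le>Suc k. c ^ i * x ^ (Suc k - i)) * (x - c) =
    x * ((\<Sum>i\<le>k. c ^ i * x ^ (k - i)) * (x - c)) + c ^ Suc k * (x - c)"
    by (simp add: algebra_simps)
  also have "\<dots> = x ^ Suc (Suc k) - c ^ Suc (Suc k)"
    unfolding Suc.IH by (simp add: algebra_simps)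
  finally show ?case .
qed simp

lemma local_factor_eq:
  assumes "prime p"
  shows "real_of_int (\<Sum>i\<le>k. chi3 p ^ i * (int p)\<^sup>2 ^ (k - i)) = local_factor p k"
proof -
  let ?S = "\<Sum>i\<le>k. real_of_int (chi3 p) ^ i * ((real p)\<^sup>2) ^ (k - i)"
  have S: "real_of_int (\<Sum>i\<le>k. chi3 p ^ i * (int p)\<^sup>2 ^ (k - i)) = ?S" by simp
  have p1: "1 < (real p)\<^sup>2"
    using prime_gt_1_nat[OF assms] by (simp add: one_less_power)
  have geo: "?S * ((real p)\<^sup>2 - real_of_int (chi3 p)) = ((real p)\<^sup>2) ^ Suc k - real_of_int (chi3 p) ^ Suc k"
    by (rule geometric_sum_mult)
  have pow: "real p ^ (2 * (k + 1)) = ((real p)\<^sup>2) ^ Suc k" "real p ^ (2 * k + 2) = ((real p)\<^sup>2) ^ Suc k"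
    by (simp_all only: power_mult[symmetric]) simp_all
  have "p mod 3 < 3" by simp
  then consider "p mod 3 = 0" | "p mod 3 = 1" | "p mod 3 = 2" by linarith
  then show ?thesis
  proof cases
    case 1
    then have "chi3 p = 0" by (simp add: chi3_def)
    with geo have "?S * (real p)\<^sup>2 = (real p)\<^sup>2 * ((real p)\<^sup>2) ^ k" by simp
    then have "?S = ((real p)\<^sup>2) ^ k" using p1 by (metis mult.commute mult_cancel_left not_one_less_zero)
    then show ?thesis unfolding S using 1 by (simp add: local_factor_def power_mult)
  next
    case 2
    then have "chi3 p = 1" by (simp add: chi3_def)
    with geo have "?S * ((real p)\<^sup>2 - 1) = real p ^ (2 * (k + 1)) - 1"
      unfolding pow by simp
    then show ?thesis unfolding S using 2 p1 by (simp add: local_factor_def eq_divide_eq)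
  next
    case 3
    then have "chi3 p = - 1" by (simp add: chi3_def)
    with geo have "?S * ((real p)\<^sup>2 + 1) = real p ^ (2 * k + 2) + (- 1) ^ k"
      unfolding pow by simp
    moreover have "(real p)\<^sup>2 + 1 \<noteq> 0" using p1 by linarith
    ultimately show ?thesis unfolding S using 3 by (simp add: local_factor_def eq_divide_eq)
  qed
qed

text \<open>Each step removes the full power of one prime, so the multiplicities of the remaining
  primes do not change.\<close>

lemma chi3_square_sum_prod:
  "0 < m \<Longrightarrow> real_of_int (chi3_square_sum m) = (\<Prod>p\<in>prime_factors m. local_factor p (multiplicity p m))"
proof (induction m rule: less_induct)
  case (less m)
  show ?case
  proof (cases "m = 1")
    case True
    then show ?thesis by (simp add: chi3_square_sum_def chi3_def)
  next
    case False
    then obtain p where p: "prime p" "p dvd m" using prime_factor_nat by blast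
    obtain m' where m': "m = p ^ multiplicity p m * m'" "\<not> p dvd m'"
      using less.prems p by (metis multiplicity_decompose' neq0_conv not_prime_unit)
    define k where "k = multiplicity p m"
    have k0: "0 < k" using p less.prems by (simp add: k_def prime_multiplicity_gt_zero_iff)
    have m: "m = p ^ k * m'" using m' by (simp add: k_def)
    have m'0: "0 < m'" using less.prems m by (auto intro: gr0I)
    have p1: "1 < p" using p prime_gt_1_nat by blast
    then have "1 < p ^ k" using k0 one_less_power by blast
    then have lt: "m' < m" using m m'0 by simp
    have pf: "prime_factors m = insert p (prime_factors m')"
      using m p k0 m'0 by (simp add: prime_factors_product prime_factorization_prime_power)
    have notin: "p \<notin> prime_factors m'" using m' by (auto dest: in_prime_factors_imp_dvd)
    have mult: "multiplicity q m = multiplicity q m'" if "q \<in> prime_factors m'" for q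
    proof -
      have "prime q" "q \<noteq> p" using that notin by auto
      then have "\<not> q dvd p ^ k" using p by (metis prime_dvd_power primes_dvd_imp_eq)
      then show ?thesis unfolding m using \<open>prime q\<close> by (simp add: multiplicity_prime_elem_times_other)
    qed
    have "real_of_int (chi3_square_sum m) = local_factor p k * real_of_int (chi3_square_sum m')"
      unfolding m chi3_square_sum_prime_power_mult[OF p(1) m'0 m'(2)] by (simp only: of_int_mult local_factor_eq[OF p(1)])
    also have "\<dots> = local_factor p k * (\<Prod>q\<in>prime_factors m'. local_factor q (multiplicity q m))"
      using less.IH[OF lt m'0] mult by simp
    also have "\<dots> = (\<Prod>q\<in>prime_factors m. local_factor q (multiplicity q m))"
      unfolding pf using notin by (simp add: k_def)
    finally show ?thesis .
  qed
qed

section \<open>Counting triples of 3-cores\<close>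

lemma finite_partitions_of_size: "finite {xs. is_partition xs \<and> sum_list xs = n}"
proof (rule finite_subset)
  have "length xs \<le> sum_list xs" if "0 \<notin> set xs" for xs :: "nat list"
    using that by (induction xs) auto
  then show "{xs. is_partition xs \<and> sum_list xs = n} \<subseteq> {xs. set xs \<subseteq> {..n} \<and> length xs \<le> n}"
    by (auto simp: is_partition_def intro: member_le_sum_list)
  show "finite {xs. set xs \<subseteq> {..n} \<and> length xs \<le> n}"
    by (rule finite_lists_length_le) simp
qed

lemma card_cores_of_size: "int (card {xs. is_t_core 3 xs \<and> sum_list xs = n}) = core_count n"
  unfolding card_three_cores card_quadratic_pairs core_count_def ..

lemma B3_eq_convolution:
  "int (B3 n) = (\<Sum>i\<le>n. core_count i * (\<Sum>j\<le>n - i. core_count j * core_count (n - i - j)))"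
proof -
  define X where "X = (\<lambda>n. {xs. is_t_core 3 xs \<and> sum_list xs = n})"
  have fin: "finite (X k)" for k
    by (rule finite_subset[OF _ finite_partitions_of_size[of k]]) (auto simp: X_def is_t_core_def)
  have cX: "int (card (X k)) = core_count k" for k
    unfolding X_def by (rule card_cores_of_size)
  let ?S = "SIGMA i:{..n}. SIGMA j:{..n - i}. X i \<times> X j \<times> X (n - i - j)"
  have "bij_betw (\<lambda>(i, j, a, b, c). (a, b, c)) ?S
    {(a, b, c). is_t_core 3 a \<and> is_t_core 3 b \<and> is_t_core 3 c \<and> sum_list a + sum_list b + sum_list c = n}"
    by (rule bij_betwI[where g = "\<lambda>(a, b, c). (sum_list a, sum_list b, a, b, c)"]) (auto simp: X_def)
  then have "B3 n = card ?S" unfolding B3_def by (rule bij_betw_same_card[symmetric])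
  also have "\<dots> = (\<Sum>i\<le>n. card (X i) * (\<Sum>j\<le>n - i. card (X j) * card (X (n - i - j))))"
    by (simp add: card_SigmaI card_cartesian_product fin sum_distrib_left)
  finally show ?thesis
    by (simp add: cX)
qed

theorem theorem3p2:
  fixes n :: nat
  shows "(int (B3 n) =
           (\<Sum>d | d dvd (n + 1) \<and> d mod 3 = 1. int (((n + 1) div d) ^ 2))
         - (\<Sum>d | d dvd (n + 1) \<and> d mod 3 = 2. int (((n + 1) div d) ^ 2)))
    \<and> (real (B3 n) =
           3 ^ (2 * multiplicity 3 (n + 1))
         * (\<Prod>p \<in> {p \<in> prime_factors (n + 1). p mod 3 = 1}.
              (real p ^ (2 * (multiplicity p (n + 1) + 1)) - 1) / (real p ^ 2 - 1))
         * (\<Prod>q \<in> {q \<in> prime_factors (n + 1). q mod 3 = 2}.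
              (real q ^ (2 * multiplicity q (n + 1) + 2) + (-1) ^ multiplicity q (n + 1))
              / (real q ^ 2 + 1)))"
proof
  let ?m = "n + 1"
  have B3: "int (B3 n) = chi3_square_sum ?m"
    unfolding B3_eq_convolution core_count_convolution_3 ..
  let ?g = "\<lambda>d. int ((?m div d)\<^sup>2)"
  have "chi3_square_sum ?m = (\<Sum>d | d dvd ?m. (if d mod 3 = 1 then ?g d else 0) - (if d mod 3 = 2 then ?g d else 0))"
    unfolding chi3_square_sum_def by (intro sum.cong refl) (auto simp: chi3_def)
  also have "\<dots> = (\<Sum>d | d dvd ?m. if d mod 3 = 1 then ?g d else 0) - (\<Sum>d | d dvd ?m. if d mod 3 = 2 then ?g d else 0)"
    by (rule sum_subtractf)
  also have "\<dots> = (\<Sum>d | d dvd ?m \<and> d mod 3 = 1. ?g d) - (\<Sum>d | d dvd ?m \<and> d mod 3 = 2. ?g d)"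
  proof -
    have "finite {d. d dvd ?m}" by simp
    then show ?thesis by (simp only: sum.inter_filter[symmetric] mem_Collect_eq)
  qed
  finally show "int (B3 n) = (\<Sum>d | d dvd (n + 1) \<and> d mod 3 = 1. ?g d) - (\<Sum>d | d dvd (n + 1) \<and> d mod 3 = 2. ?g d)"
    unfolding B3 .
  let ?P = "\<lambda>r. {p \<in> prime_factors ?m. p mod 3 = r}"
  let ?L = "\<lambda>p. local_factor p (multiplicity p ?m)"
  have m0: "0 < ?m" by simp
  have "real (B3 n) = real_of_int (chi3_square_sum ?m)" using B3 by (metis of_int_of_nat_eq)
  also have "\<dots> = prod ?L (prime_factors ?m)" by (rule chi3_square_sum_prod) simp
  also have "prime_factors ?m = ?P 0 \<union> ?P 1 \<union> ?P 2"
  proof -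
    have "p mod 3 < 3" for p :: nat by simp
    then have "p mod 3 = 0 \<or> p mod 3 = 1 \<or> p mod 3 = 2" for p :: nat by (metis less_Suc_eq numeral_3_eq_3 One_nat_def Suc_1 less_zeroE)
    then show ?thesis by blast
  qed
  also have "prod ?L \<dots> = prod ?L (?P 0) * prod ?L (?P 1) * prod ?L (?P 2)"
    by (subst prod.union_disjoint; (subst prod.union_disjoint)?; auto)
  \<comment> \<open>The only prime divisible by 3 is 3 itself. If it does not divide
    \<open>n + 1\<close>, the product is empty and the exponent on the right is 0.\<close>
  also have "prod ?L (?P 0) = 3 ^ (2 * multiplicity 3 ?m)"
  proof -
    have three: "p = 3" if "prime p" "p mod 3 = 0" for p :: nat
      using that by (metis mod_0_imp_dvd numeral_eq_one_iff prime_nat_iff semiring_norm(86))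
    show ?thesis
    proof (cases "3 dvd ?m")
      case True
      have "prime (3 :: nat)" by simp
      then have "?P 0 = {3}" using True three by (auto simp: in_prime_factors_iff)
      then show ?thesis by (simp add: local_factor_def)
    next
      case False
      then have "?P 0 = {}" using three by (auto simp: in_prime_factors_iff)
      moreover have "multiplicity 3 ?m = 0" using False by (rule not_dvd_imp_multiplicity_0)
      ultimately show ?thesis by (simp only: prod.empty) simp
    qed
  qed
  also have "prod ?L (?P 1) = (\<Prod>p \<in> ?P 1.
      (real p ^ (2 * (multiplicity p ?m + 1)) - 1) / (real p ^ 2 - 1))"
    by (rule prod.cong) (simp_all add: local_factor_def)
  also have "prod ?L (?P 2) = (\<Prod>q \<in> ?P 2.
      (real q ^ (2 * multiplicity q ?m + 2) + (-1) ^ multiplicity q ?m) / (real q ^ 2 + 1))"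
    by (rule prod.cong) (simp_all add: local_factor_def)
  finally show "real (B3 n) = 3 ^ (2 * multiplicity 3 (n + 1))
         * (\<Prod>p \<in> ?P 1. (real p ^ (2 * (multiplicity p (n + 1) + 1)) - 1) / (real p ^ 2 - 1))
         * (\<Prod>q \<in> ?P 2. (real q ^ (2 * multiplicity q (n + 1) + 2) + (-1) ^ multiplicity q (n + 1))
              / (real q ^ 2 + 1))" .
qed

end
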